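(* Let $G$ be a group generated by a polynomial automaton of degree $d$. Then $\mathrm{WP}_G\in\mathrm{DTIME}_*\big(n(\log n)^{(d+1)^2}\big)$. If moreover $G$ is contracting, then $\mathrm{WP}_G\in\mathrm{DTIME}_*\big(n(\log n)^{d+1}\big)$.
   Context: An automaton over a finite alphabet $X$ is $A=(S,X,t,o)$ with finite state set $S$, transition map $t:S\times X\to S$, output map $o:S\times X\to X$, extended to words by $t(s,xv)=t(t(s,x),v)$, $o(s,xv)=o(s,x)o(t(s,x),v)$. It is assumed invertible, minimal (distinct states define distinct transformations of $X^{*}$), with $S$ closed under inversion; $G$ is the group of transformations $o(s,\cdot)$ of $X^{*}$ generated by $S$. For $s\in S$, $v\in X^{*}$, $s|_v=t(s,v)$, and for a word $w=s_1\cdots s_n\in S^{*}$ and $x\in X$, the section $w|_x=s_1'\cdots s_n'$ with $s_i'=t(s_i,x_i)$, $x_1=x$, $x_{i+1}=o(s_i,x_i)$. The trivial state $e$ is the state acting as the identity. The automaton is polynomial if there is a polynomial $P$ such that for every $s\in S$ and $n\in\mathbb{N}$ at most $P(n)$ words $v\in X^n$ satisfy $s|_v\neq e$; its degree is the least degree of such $P$. $G$ is contracting (for this automaton) if $l_S(w|_x)<|w|$ for all $x\in X$ and all sufficiently long $w\in S^{*}$, where $l_S$ is word length in $G$. $\mathrm{WP}_G=\{w\in S^{*}: w=_Ge\}$; $\mathrm{DTIME}_*(t(n))$ is the class of languages decided in time $O(t(n))$ by a deterministic multi-tape Turing machine. *)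

theory Defs
  imports Complex_Main "HOL-Computational_Algebra.Polynomial"
begin

text \<open>States are the elements of a finite type 's (the state set S is all of 's),
  letters the elements of a finite type 'x.  trn is the transition map t, otp the
  output map o.\<close>

fun aut_out :: "('s \<Rightarrow> 'x \<Rightarrow> 's) \<Rightarrow> ('s \<Rightarrow> 'x \<Rightarrow> 'x) \<Rightarrow> 's \<Rightarrow> 'x list \<Rightarrow> 'x list" where
  "aut_out trn otp s [] = []"
| "aut_out trn otp s (x # v) = otp s x # aut_out trn otp (trn s x) v"

definition aut_tr :: "('s \<Rightarrow> 'x \<Rightarrow> 's) \<Rightarrow> 's \<Rightarrow> 'x list \<Rightarrow> 's" where
  "aut_tr trn s v = foldl trn s v"

definition invertible_aut :: "('s \<Rightarrow> 'x \<Rightarrow> 'x) \<Rightarrow> bool" where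
  "invertible_aut otp \<longleftrightarrow> (\<forall>s. bij (otp s))"

definition minimal_aut :: "('s \<Rightarrow> 'x \<Rightarrow> 's) \<Rightarrow> ('s \<Rightarrow> 'x \<Rightarrow> 'x) \<Rightarrow> bool" where
  "minimal_aut trn otp \<longleftrightarrow> inj (aut_out trn otp)"

definition inverse_closed_aut :: "('s \<Rightarrow> 'x \<Rightarrow> 's) \<Rightarrow> ('s \<Rightarrow> 'x \<Rightarrow> 'x) \<Rightarrow> bool" where
  "inverse_closed_aut trn otp \<longleftrightarrow>
     (\<forall>s. \<exists>s'. (\<forall>v. aut_out trn otp s' (aut_out trn otp s v) = v)
              \<and> (\<forall>v. aut_out trn otp s (aut_out trn otp s' v) = v))"

fun word_act :: "('s \<Rightarrow> 'x \<Rightarrow> 's) \<Rightarrow> ('s \<Rightarrow> 'x \<Rightarrow> 'x) \<Rightarrow> 's list \<Rightarrow> 'x list \<Rightarrow> 'x list" where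
  "word_act trn otp [] v = v"
| "word_act trn otp (s # w) v = word_act trn otp w (aut_out trn otp s v)"

fun word_sec :: "('s \<Rightarrow> 'x \<Rightarrow> 's) \<Rightarrow> ('s \<Rightarrow> 'x \<Rightarrow> 'x) \<Rightarrow> 's list \<Rightarrow> 'x \<Rightarrow> 's list" where
  "word_sec trn otp [] x = []"
| "word_sec trn otp (s # w) x = trn s x # word_sec trn otp w (otp s x)"

definition WP :: "('s \<Rightarrow> 'x \<Rightarrow> 's) \<Rightarrow> ('s \<Rightarrow> 'x \<Rightarrow> 'x) \<Rightarrow> 's list set" where
  "WP trn otp = {w. word_act trn otp w = id}"

definition word_len :: "('s \<Rightarrow> 'x \<Rightarrow> 's) \<Rightarrow> ('s \<Rightarrow> 'x \<Rightarrow> 'x) \<Rightarrow> 's list \<Rightarrow> nat" where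
  "word_len trn otp w = (LEAST n. \<exists>u. length u = n \<and> word_act trn otp u = word_act trn otp w)"

definition contracting_aut :: "('s \<Rightarrow> 'x \<Rightarrow> 's) \<Rightarrow> ('s \<Rightarrow> 'x \<Rightarrow> 'x) \<Rightarrow> bool" where
  "contracting_aut trn otp \<longleftrightarrow>
     (\<exists>N. \<forall>w. N \<le> length w \<longrightarrow> (\<forall>x. word_len trn otp (word_sec trn otp w x) < length w))"

definition nontriv_count :: "('s \<Rightarrow> 'x \<Rightarrow> 's) \<Rightarrow> ('s \<Rightarrow> 'x \<Rightarrow> 'x) \<Rightarrow> 's \<Rightarrow> nat \<Rightarrow> nat" where
  "nontriv_count trn otp s n =
     card {v :: 'x list. length v = n \<and> aut_out trn otp (aut_tr trn s v) \<noteq> id}"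

definition poly_bound_of_degree :: "('s \<Rightarrow> 'x \<Rightarrow> 's) \<Rightarrow> ('s \<Rightarrow> 'x \<Rightarrow> 'x) \<Rightarrow> nat \<Rightarrow> bool" where
  "poly_bound_of_degree trn otp k \<longleftrightarrow>
     (\<exists>P :: real poly. degree P = k \<and>
        (\<forall>s n. real (nontriv_count trn otp s n) \<le> poly P (real n)))"

definition polynomial_aut :: "('s \<Rightarrow> 'x \<Rightarrow> 's) \<Rightarrow> ('s \<Rightarrow> 'x \<Rightarrow> 'x) \<Rightarrow> bool" where
  "polynomial_aut trn otp \<longleftrightarrow> (\<exists>k. poly_bound_of_degree trn otp k)"

definition aut_degree :: "('s \<Rightarrow> 'x \<Rightarrow> 's) \<Rightarrow> ('s \<Rightarrow> 'x \<Rightarrow> 'x) \<Rightarrow> nat" where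
  "aut_degree trn otp = (LEAST k. poly_bound_of_degree trn otp k)"

text \<open>States are naturals < tm_nstates, tape symbols naturals < tm_nsyms, 0 is the blank.
  tm_delta q r gives (new state, symbols written, head moves in {-1,0,1}) for each tape.
  Tape 0 is the input tape.  acc/rej are halting states.\<close>

record tm =
  tm_tapes :: nat
  tm_nstates :: nat
  tm_nsyms :: nat
  tm_delta :: "nat \<Rightarrow> nat list \<Rightarrow> nat \<times> nat list \<times> int list"
  tm_start :: nat
  tm_acc :: nat
  tm_rej :: nat

type_synonym tm_config = "nat \<times> (int \<Rightarrow> nat) list \<times> int list"

definition tm_wf :: "tm \<Rightarrow> bool" where
  "tm_wf M \<longleftrightarrow> 1 \<le> tm_tapes M \<and> 0 < tm_nsyms M \<and>
     tm_start M < tm_nstates M \<and> tm_acc M < tm_nstates M \<and> tm_rej M < tm_nstates M \<and>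
     tm_acc M \<noteq> tm_rej M \<and>
     (\<forall>q r. q < tm_nstates M \<and> length r = tm_tapes M \<and> set r \<subseteq> {..<tm_nsyms M} \<longrightarrow>
        (case tm_delta M q r of (q', ws, mv) \<Rightarrow>
           q' < tm_nstates M \<and> length ws = tm_tapes M \<and> set ws \<subseteq> {..<tm_nsyms M} \<and>
           length mv = tm_tapes M \<and> set mv \<subseteq> {-1, 0, 1}))"

definition tm_step :: "tm \<Rightarrow> tm_config \<Rightarrow> tm_config" where
  "tm_step M c = (case c of (q, tp, hs) \<Rightarrow>
     if q = tm_acc M \<or> q = tm_rej M then c
     else (case tm_delta M q (map (\<lambda>i. (tp ! i) (hs ! i)) [0..<tm_tapes M]) of (q', ws, mv) \<Rightarrow>
       (q', map (\<lambda>i. (tp ! i)((hs ! i) := ws ! i)) [0..<tm_tapes M],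
            map (\<lambda>i. hs ! i + mv ! i) [0..<tm_tapes M])))"

definition tm_init :: "tm \<Rightarrow> ('a \<Rightarrow> nat) \<Rightarrow> 'a list \<Rightarrow> tm_config" where
  "tm_init M enc w =
     (tm_start M,
      (\<lambda>i. if 0 \<le> i \<and> i < int (length w) then enc (w ! nat i) else 0)
        # replicate (tm_tapes M - 1) (\<lambda>_. 0),
      replicate (tm_tapes M) 0)"

definition tm_run :: "tm \<Rightarrow> ('a \<Rightarrow> nat) \<Rightarrow> 'a list \<Rightarrow> nat \<Rightarrow> tm_config" where
  "tm_run M enc w m = (tm_step M ^^ m) (tm_init M enc w)"

definition enc_wf :: "tm \<Rightarrow> ('a \<Rightarrow> nat) \<Rightarrow> bool" where
  "enc_wf M enc \<longleftrightarrow> inj enc \<and> (\<forall>a. 0 < enc a \<and> enc a < tm_nsyms M)"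

definition tm_decides :: "tm \<Rightarrow> ('a \<Rightarrow> nat) \<Rightarrow> 'a list set \<Rightarrow> bool" where
  "tm_decides M enc L \<longleftrightarrow>
     (\<forall>w. \<exists>m. fst (tm_run M enc w m) = (if w \<in> L then tm_acc M else tm_rej M))"

definition tm_halts_within :: "tm \<Rightarrow> ('a \<Rightarrow> nat) \<Rightarrow> 'a list \<Rightarrow> real \<Rightarrow> bool" where
  "tm_halts_within M enc w T \<longleftrightarrow>
     (\<exists>m. real m \<le> T \<and> fst (tm_run M enc w m) \<in> {tm_acc M, tm_rej M})"

definition DTIME_star :: "(nat \<Rightarrow> real) \<Rightarrow> ('a::finite) list set set" where
  "DTIME_star T = {L. \<exists>M enc C N. tm_wf M \<and> enc_wf M enc \<and> tm_decides M enc L \<and>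
       (\<forall>w. N \<le> length w \<longrightarrow> tm_halts_within M enc w (C * T (length w)))}"

end

(*
  A word w acts trivially on X^D iff, at all levels k < D, its sections at words of X^k fix all letters.
  The sections of level k with trivial letters removed have total length at most n P(k), since each
  letter of w contributes its nontrivial sections exactly once, and one level is computed from the
  previous one in one pass per letter of X. So D levels take time O(n D^(d+1)), and it remains to
  see how deep a nontrivial word of length n has to be inspected.

  If G is contracting, lengths drop by a constant factor, so D = O(log n) suffices. In general
  D = O((log n)^(d+1)). Pass to the alphabet Z = X^m, where m is divisible by all cycle lengths. By
  induction on the degree k, every section of a letter of degree k is either of lower degree or a
  loop: it reproduces itself at exactly one letter x of Z and is of lower degree elsewhere. Let E
  bound the time after which the sections of lower degree words of length n along a constant path
  x, x, x, ... become constant. If two consecutive loops survive E + 1 steps along a path, the word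
  between them has become constant, so they survive together from then on and may be regarded as
  a single loop. Hence the number of loops is halved every E + 1 levels, and after
  O(E log n) levels at most one is left; that case reduces to lower degree after a conjugation.
*)
theory Submission
  imports Defs
begin

section \<open>Sections of words along paths\<close>

text \<open>Constant paths carry the whole argument. A loop survives only while it reads its own
  letter, and then it answers with a constant path, which is what the word to its right reads. So
  the only facts needed about lower levels are a stabilisation time E along constant paths and a
  detection depth D. For words of length at most \<open>2 ^ t\<close>, one level up multiplies the
  bound for either by \<open>3 * Suc t\<close>.

  Levels are numbered by degree plus one: finitary states have level 0 and all states have level
  \<open>Suc d\<close>. This makes the depth O((log n)^(d+1)); inserted into the cost n D^(d+1) of
  inspecting D levels, it gives the exponent (d+1)^2.

  The contracting hypothesis promises a loss of only one letter for a long word. Applying it to each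
  factor of a fixed length N turns this into a loss proportional to the length.

  The machine must also find out how many levels to inspect without exceeding the time bound: it
  obtains log n in unary by repeated halving, whose total cost is a geometric sum.\<close>

definition path_sec :: "('s \<Rightarrow> 'x \<Rightarrow> 's) \<Rightarrow> ('s \<Rightarrow> 'x \<Rightarrow> 'x) \<Rightarrow> 's list \<Rightarrow> 'x list \<Rightarrow> 's list" where
  "path_sec tr out w v = foldl (word_sec tr out) w v"

lemma path_sec_Nil [simp]: "path_sec tr out w [] = w"
  and path_sec_Cons [simp]: "path_sec tr out w (z # v) = path_sec tr out (word_sec tr out w z) v"
  and path_sec_append: "path_sec tr out w (v @ v') = path_sec tr out (path_sec tr out w v) v'"
  by (simp_all add: path_sec_def)

lemma path_sec_Nil_word [simp]: "path_sec tr out [] v = []"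
  by (induction v) auto

lemma word_act_Nil [simp]: "word_act tr out w [] = []"
  by (induction w) auto

lemma word_act_Cons_letter:
  "word_act tr out w (z # v) = fold out w z # word_act tr out (word_sec tr out w z) v"
  by (induction w arbitrary: z v) auto

lemma word_act_append_word: "word_act tr out (u @ w) v = word_act tr out w (word_act tr out u v)"
  by (induction u arbitrary: v) auto

lemma word_sec_append: "word_sec tr out (u @ w) z = word_sec tr out u z @ word_sec tr out w (fold out u z)"
  by (induction u arbitrary: z) auto

lemma length_word_sec [simp]: "length (word_sec tr out w z) = length w"
  by (induction w arbitrary: z) auto

lemma length_path_sec [simp]: "length (path_sec tr out w v) = length w"
  by (induction v arbitrary: w) auto

lemma length_aut_out [simp]: "length (aut_out tr out s v) = length v"
  by (induction v arbitrary: s) auto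

lemma length_word_act [simp]: "length (word_act tr out w v) = length v"
  by (induction w arbitrary: v) auto

lemma word_act_append_path:
  "word_act tr out w (v @ v') = word_act tr out w v @ word_act tr out (path_sec tr out w v) v'"
  by (induction v arbitrary: w) (auto simp: word_act_Cons_letter)

lemma word_act_extend_prefix:
  assumes "\<forall>v. length v = N \<longrightarrow> word_act tr out w v = v" "length v \<le> N"
  shows "word_act tr out w v = v"
proof -
  have "word_act tr out w (v @ replicate (N - length v) undefined) = v @ replicate (N - length v) undefined"
    using assms by auto
  then show ?thesis by (simp add: word_act_append_path)
qed

lemma path_sec_append_word:
  "path_sec tr out (u @ w) v = path_sec tr out u v @ path_sec tr out w (word_act tr out u v)"
  by (induction v arbitrary: u w) (auto simp: word_act_Cons_letter word_sec_append)

lemma replicate_Suc_append: "replicate (Suc n) x = replicate n x @ [x]"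
  by (simp add: replicate_append_same)


section \<open>Detection depth over a filtered automaton\<close>

text \<open>The letters form a set \<open>Z\<close> inside their type because the instance takes the
  words of length m inside the type of all words. \<open>Lo_0\<close> and \<open>Lo_Suc\<close>
  constrain only sections at a letter, since a state itself need not lie on a cycle; one letter of
  \<open>Z\<close> is enough to reach one.\<close>

locale loop_filtration =
  fixes tr :: "'s \<Rightarrow> 'z \<Rightarrow> 's" and out :: "'s \<Rightarrow> 'z \<Rightarrow> 'z" and Z :: "'z set" and Lo :: "nat \<Rightarrow> 's set"
  assumes out_bij: "bij_betw (out s) Z Z"
    and Z_nonempty: "Z \<noteq> {}"
    and Lo_closed: "s \<in> Lo k \<Longrightarrow> z \<in> Z \<Longrightarrow> tr s z \<in> Lo k"
    and Lo_0: "s \<in> Lo 0 \<Longrightarrow> z \<in> Z \<Longrightarrow> z' \<in> Z \<Longrightarrow> tr (tr s z) z' = tr s z \<and> out (tr s z) z' = z'"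
    and Lo_Suc: "s \<in> Lo (Suc k) \<Longrightarrow> z \<in> Z \<Longrightarrow>
      tr s z \<in> Lo k \<or> (\<exists>x\<in>Z. tr (tr s z) x = tr s z \<and> (\<forall>z'\<in>Z - {x}. tr (tr s z) z' \<in> Lo k))"
begin

abbreviation "sec \<equiv> word_sec tr out"
abbreviation "psec \<equiv> path_sec tr out"
abbreviation "act \<equiv> word_act tr out"

lemma fold_out_bij: "bij_betw (fold out w) Z Z"
proof (induction w)
  case Nil then show ?case by (simp add: bij_betw_def)
next
  case (Cons s w)
  from bij_betw_trans[OF out_bij[of s] Cons] show ?case by (simp add: comp_def)
qed

lemma fold_out_in: "z \<in> Z \<Longrightarrow> fold out w z \<in> Z"
  using fold_out_bij[of w] by (auto simp: bij_betw_def)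

lemma fold_out_eq_iff: "z \<in> Z \<Longrightarrow> z' \<in> Z \<Longrightarrow> fold out w z = fold out w z' \<longleftrightarrow> z = z'"
  using fold_out_bij[of w] by (auto simp: bij_betw_def inj_on_def)

lemma act_in_lists: "v \<in> lists Z \<Longrightarrow> act w v \<in> lists Z"
  by (induction v arbitrary: w) (auto simp: word_act_Cons_letter fold_out_in)

lemma act_surj: "v \<in> lists Z \<Longrightarrow> \<exists>v'\<in>lists Z. length v' = length v \<and> act w v' = v"
proof (induction v arbitrary: w)
  case Nil then show ?case by (intro bexI[of _ "[]"]) auto
next
  case (Cons z v)
  then obtain y where y: "y \<in> Z" "fold out w y = z"
    using fold_out_bij[of w] unfolding bij_betw_def by (metis Cons_in_lists_iff imageE)
  have "v \<in> lists Z" using Cons.prems by simp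
  then obtain v' where "v' \<in> lists Z" "length v' = length v" "act (sec w y) v' = v"
    using Cons.IH[of "sec w y"] by blast
  with y show ?case by (intro bexI[of _ "y # v'"]) (auto simp: word_act_Cons_letter)
qed

lemma act_inj: "v \<in> lists Z \<Longrightarrow> v' \<in> lists Z \<Longrightarrow> act w v = act w v' \<Longrightarrow> v = v'"
proof (induction v arbitrary: w v')
  case Nil
  then show ?case by (metis length_0_conv length_word_act word_act_Nil)
next
  case (Cons z v)
  then obtain z' u where "v' = z' # u" by (cases v') (auto simp: word_act_Cons_letter)
  with Cons show ?case by (auto simp: word_act_Cons_letter fold_out_eq_iff)
qed

definition low :: "nat \<Rightarrow> 's list \<Rightarrow> bool" where "low k w \<longleftrightarrow> set w \<subseteq> Lo k"

lemma low_append [simp]: "low k (u @ w) \<longleftrightarrow> low k u \<and> low k w"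
  and low_Nil [simp]: "low k []"
  and low_Cons: "low k (s # w) \<longleftrightarrow> s \<in> Lo k \<and> low k w"
  by (auto simp: low_def)

lemma low_sec: "low k w \<Longrightarrow> z \<in> Z \<Longrightarrow> low k (sec w z)"
proof (induction w arbitrary: z)
  case (Cons s w)
  then show ?case using out_bij[of s] by (auto simp: low_Cons Lo_closed bij_betw_def)
qed auto

lemma low_psec: "low k w \<Longrightarrow> v \<in> lists Z \<Longrightarrow> low k (psec w v)"
  by (induction v arbitrary: w) (auto simp: low_sec)

section \<open>Loops, merging of neighbouring loops, and the halving of their number\<close>

text \<open>The words that behave like a single loop state of level \<open>Suc k\<close>; the empty word is allowed,
  so that block counts are upper bounds.\<close>

definition loop_at :: "nat \<Rightarrow> 'z \<Rightarrow> 's list \<Rightarrow> bool" where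
  "loop_at k x g \<longleftrightarrow> x \<in> Z \<and> sec g x = g \<and> (\<forall>z\<in>Z - {x}. low k (sec g z))"

fun blocks :: "nat \<Rightarrow> nat \<Rightarrow> 's list \<Rightarrow> bool" where
  "blocks k 0 w \<longleftrightarrow> low k w"
| "blocks k (Suc h) w \<longleftrightarrow> (\<exists>u x g w'. w = u @ g @ w' \<and> low k u \<and> loop_at k x g \<and> blocks k h w')"

lemma loop_at_Nil: "x \<in> Z \<Longrightarrow> loop_at k x []"
  by (simp add: loop_at_def)

lemma blocks_mono: assumes "h \<le> h'" "blocks k h w" shows "blocks k h' w"
  using assms
proof (induction rule: dec_induct)
  case (step n)
  obtain x where "x \<in> Z" using Z_nonempty by auto
  then have "w = [] @ [] @ w \<and> low k [] \<and> loop_at k x [] \<and> blocks k n w"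
    using step loop_at_Nil by simp
  then show ?case unfolding blocks.simps by blast
qed

lemma blocks_low_append: "low k u \<Longrightarrow> blocks k h w \<Longrightarrow> blocks k h (u @ w)"
proof (cases h)
  case (Suc n)
  assume "low k u" "blocks k h w"
  with Suc obtain u' x g w' where "w = u' @ g @ w'" "low k u'" "loop_at k x g" "blocks k n w'" by auto
  with \<open>low k u\<close> have "u @ w = (u @ u') @ g @ w' \<and> low k (u @ u') \<and> loop_at k x g \<and> blocks k n w'"
    by simp
  then show ?thesis unfolding Suc blocks.simps by blast
qed simp

text \<open>A single letter other than x makes the section low, and low words stay low. The constant
  output in the surviving case is what lets the next word be studied along constant paths
  only.\<close>

lemma loop_at_path:
  assumes "loop_at k x g" "v \<in> lists Z"
  shows "if v = replicate (length v) x then psec g v = g \<and> act g v = replicate (length v) (fold out g x)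
    else low k (psec g v)"
  using assms
proof (induction v)
  case (Cons z v)
  show ?case
  proof (cases "z = x")
    case True
    with Cons show ?thesis by (auto simp: loop_at_def word_act_Cons_letter)
  next
    case False
    with Cons have "low k (sec g z)" by (auto simp: loop_at_def)
    with Cons False show ?thesis by (auto simp: low_psec)
  qed
qed auto

text \<open>Only low words between loops need to stabilise, and between surviving loops they read
  constant paths. Sections keep the length of a word, so the bound n holds at every later
  level.\<close>

definition stable_after :: "nat \<Rightarrow> nat \<Rightarrow> nat \<Rightarrow> bool" where
  "stable_after k n E \<longleftrightarrow> (\<forall>w x. low k w \<longrightarrow> length w \<le> n \<longrightarrow> x \<in> Z \<longrightarrow>
     sec (psec w (replicate E x)) x = psec w (replicate E x))"

text \<open>A low word between two loops that survive together for \<open>Suc E\<close> steps has become stable,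
  so the two loops and the word merge into a single loop.\<close>

lemma loop_merge:
  assumes E: "stable_after k n E" and u: "low k u" "length u \<le> n"
    and g: "loop_at k x g" and g': "loop_at k x' g'"
    and eq: "act u (replicate (Suc E) (fold out g x)) = replicate (Suc E) x'"
  shows "loop_at k x (g @ psec u (replicate (Suc E) (fold out g x)) @ g')"
proof -
  define y where "y = fold out g x"
  define r where "r = psec u (replicate E y)"
  have xZ: "x \<in> Z" "x' \<in> Z" using g g' by (auto simp: loop_at_def)
  have yZ: "y \<in> Z" using xZ by (simp add: y_def fold_out_in)
  have r: "sec r y = r" using E u yZ by (auto simp: stable_after_def r_def)
  have r': "psec u (replicate (Suc E) y) = r"
    by (simp only: replicate_Suc_append path_sec_append) (simp add: r r_def[symmetric])
  \<comment> \<open>The first E letters bring the word to r; the extra letter in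
    \<open>Suc E\<close> is read by r itself and shows that r maps y to x'. Without it the second
    loop could still be left.\<close>
  have "act u (replicate E y) @ [fold out r y] = replicate E x' @ [x']"
    using eq unfolding y_def[symmetric] replicate_Suc_append
    by (simp add: word_act_append_path word_act_Cons_letter r_def)
  then have out: "fold out r y = x'" by simp
  have rl: "low k r" using u yZ by (auto simp: r_def intro!: low_psec)
  have 1: "sec (g @ r @ g') x = g @ r @ g'"
    using g g' r out by (auto simp: word_sec_append loop_at_def y_def)
  have 2: "low k (sec (g @ r @ g') z)" if z: "z \<in> Z - {x}" for z
  proof -
    \<comment> \<open>Since g and r permute \<open>Z\<close>, a letter different from x reaches g'
      as a letter different from x', so both loops are left at the same moment.\<close>
    have "fold out g z \<noteq> y" using z xZ by (auto simp: y_def fold_out_eq_iff)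
    then have "fold out r (fold out g z) \<noteq> x'"
      using out z xZ yZ by (metis DiffE fold_out_eq_iff fold_out_in)
    moreover have "fold out r (fold out g z) \<in> Z" using z by (auto intro!: fold_out_in)
    ultimately show ?thesis
      using g g' z rl by (auto simp: word_sec_append loop_at_def low_sec fold_out_in)
  qed
  show ?thesis using 1 2 xZ r' unfolding y_def[symmetric] by (auto simp: loop_at_def)
qed

lemma blocks_Suc_I:
  "low k u \<Longrightarrow> loop_at k x g \<Longrightarrow> low k u' \<Longrightarrow> blocks k h w \<Longrightarrow> blocks k (Suc h) (u @ g @ u' @ w)"
  unfolding blocks.simps using blocks_low_append by blast

text \<open>Loops are taken in consecutive pairs from the left. Either a member of the pair leaves
  its cycle and becomes low, or both survive \<open>Suc E\<close> letters and merge; each pair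
  leaves at most one loop. An unpaired last loop may remain, hence the rounding up.\<close>

lemma blocks_halve:
  assumes E: "stable_after k n E"
  shows "blocks k h w \<Longrightarrow> length w \<le> n \<Longrightarrow> v \<in> lists Z \<Longrightarrow> length v = Suc E \<Longrightarrow>
    blocks k (Suc h div 2) (psec w v)"
proof (induction h arbitrary: w v rule: induct_nat_012)
  case 0
  then show ?case by (simp add: low_psec)
next
  case 1
  then obtain u x g w' where w: "w = u @ g @ w'" and u: "low k u" and g: "loop_at k x g" and w': "low k w'"
    by auto
  let ?v1 = "act u v" let ?v2 = "act g ?v1"
  have v: "?v1 \<in> lists Z" "?v2 \<in> lists Z" using 1 by (auto intro!: act_in_lists)
  have s: "psec w v = psec u v @ psec g ?v1 @ psec w' ?v2"
    by (simp add: w path_sec_append_word)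
  have lows: "low k (psec u v)" "low k (psec w' ?v2)" using u w' v 1 by (auto intro!: low_psec)
  show ?case
  proof (cases "?v1 = replicate (length ?v1) x")
    case True
    then have "psec g ?v1 = g" using loop_at_path[OF g v(1)] by auto
    then show ?thesis using lows g s by auto
  next
    case False
    then have "low k (psec g ?v1)" using loop_at_path[OF g v(1)] by auto
    then have "blocks k 0 (psec w v)" using lows s by auto
    then have "blocks k 1 (psec w v)" by (rule blocks_mono[rotated]) simp
    then show ?thesis by simp
  qed
next
  case (ge2 h)
  from "ge2.prems"(1) obtain u x g w1 where w: "w = u @ g @ w1" and u: "low k u" and g: "loop_at k x g"
    and w1': "blocks k (Suc h) w1" unfolding blocks.simps(2)[of k "Suc h"] by blast
  from w1' obtain u' x' g' w' where w1: "w1 = u' @ g' @ w'" and u': "low k u'" and g': "loop_at k x' g'"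
    and w': "blocks k h w'" unfolding blocks.simps(2)[of k h] by blast
  let ?v1 = "act u v" let ?v2 = "act g ?v1" let ?v3 = "act u' ?v2" let ?v4 = "act g' ?v3"
  have v: "?v1 \<in> lists Z" "?v2 \<in> lists Z" "?v3 \<in> lists Z" "?v4 \<in> lists Z"
    using ge2 by (auto intro!: act_in_lists)
  have s: "psec w v = psec u v @ psec g ?v1 @ psec u' ?v2 @ psec g' ?v3 @ psec w' ?v4"
    by (simp add: w w1 path_sec_append_word)
  have lows: "low k (psec u v)" "low k (psec u' ?v2)" using u u' v ge2 by (auto intro!: low_psec)
  have IH: "blocks k (Suc h div 2) (psec w' ?v4)"
    using ge2 w w1 w' v by (intro "ge2.IH"(1)) auto
  have "blocks k (Suc (Suc h div 2)) (psec w v)"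
  proof (cases "?v1 = replicate (length ?v1) x")
    case False
    then have l: "low k (psec g ?v1)" using loop_at_path[OF g v(1)] by auto
    show ?thesis
    proof (cases "?v3 = replicate (length ?v3) x'")
      case True
      then have "psec g' ?v3 = g'" using loop_at_path[OF g' v(3)] by auto
      then show ?thesis
        using blocks_Suc_I[of k "psec u v @ psec g ?v1 @ psec u' ?v2" x' g' "[]"] lows l g' s IH by auto
    next
      case False
      then have "low k (psec g' ?v3)" using loop_at_path[OF g' v(3)] by auto
      then have "blocks k (Suc h div 2) (psec w v)"
        using blocks_low_append[of k "psec u v @ psec g ?v1 @ psec u' ?v2 @ psec g' ?v3"] lows l s IH
        by auto
      then show ?thesis using blocks_mono[of "Suc h div 2" "Suc (Suc h div 2)"] by auto
    qed
  next
    case True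
    then have 1: "psec g ?v1 = g" "?v2 = replicate (Suc E) (fold out g x)"
      using loop_at_path[OF g v(1)] ge2 by auto
    show ?thesis
    proof (cases "?v3 = replicate (length ?v3) x'")
      case False
      then have "low k (psec g' ?v3)" using loop_at_path[OF g' v(3)] by auto
      then show ?thesis
        using blocks_Suc_I[of k "psec u v" x g "psec u' ?v2 @ psec g' ?v3"] lows g s IH 1(1) by auto
    next
      case True
      then have 3: "psec g' ?v3 = g'" "?v3 = replicate (Suc E) x'"
        using loop_at_path[OF g' v(3)] ge2 by auto
      have "loop_at k x (g @ psec u' (replicate (Suc E) (fold out g x)) @ g')"
        using E u' g g' 3(2) 1(2) "ge2.prems" w w1 by (intro loop_merge[where n = n and x' = x']) auto
      then have "loop_at k x (g @ psec u' ?v2 @ g')" using 1(2) by simp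
      then show ?thesis
        using blocks_Suc_I[of k "psec u v" x "g @ psec u' ?v2 @ g'" "[]"] lows s IH 1(1) 3(1) by auto
    qed
  qed
  then show ?case by simp
qed

text \<open>One letter is spent to bring every state of the word onto a cycle or down a level, so
  each state accounts for at most one loop.\<close>

lemma blocks_initial:
  assumes "low (Suc k) w" "z \<in> Z" shows "blocks k (length w) (sec w z)"
  using assms
proof (induction w arbitrary: z)
  case (Cons s w)
  let ?s = "tr s z"
  have oz: "out s z \<in> Z" using Cons out_bij[of s] by (auto simp: bij_betw_def)
  with Cons have IH: "blocks k (length w) (sec w (out s z))" by (auto simp: low_Cons)
  from Cons have "s \<in> Lo (Suc k)" by (auto simp: low_Cons)
  from Lo_Suc[OF this Cons.prems(2)] show ?case
  proof
    assume "?s \<in> Lo k"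
    then have "blocks k (length w) ([?s] @ sec w (out s z))"
      using IH by (intro blocks_low_append) (auto simp: low_Cons)
    then show ?thesis using blocks_mono[of "length w" "Suc (length w)"] by simp
  next
    assume "\<exists>x\<in>Z. tr ?s x = ?s \<and> (\<forall>z'\<in>Z - {x}. tr ?s z' \<in> Lo k)"
    then obtain x where "loop_at k x [?s]" by (auto simp: loop_at_def low_Cons)
    then show ?thesis using blocks_Suc_I[of k "[]" x "[?s]" "[]"] IH by simp
  qed
qed auto

lemma blocks_iterate:
  assumes E: "stable_after k n E"
  shows "blocks k (2 ^ t) w \<Longrightarrow> length w \<le> n \<Longrightarrow> v \<in> lists Z \<Longrightarrow> length v = t * Suc E \<Longrightarrow>
    blocks k 1 (psec w v)"
proof (induction t arbitrary: w v)
  case (Suc t)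
  define v1 where "v1 = take (Suc E) v"
  define v2 where "v2 = drop (Suc E) v"
  have v: "v = v1 @ v2" "length v1 = Suc E" "length v2 = t * Suc E" "v1 \<in> lists Z" "v2 \<in> lists Z"
    using Suc.prems(3,4) by (auto simp: v1_def v2_def dest: in_set_takeD in_set_dropD)
  \<comment> \<open>Counting with powers of two makes the rounding up in \<open>blocks_halve\<close>
    harmless.\<close>
  have "Suc (2 ^ Suc t) div 2 = (2::nat) ^ t" by simp
  then have "blocks k (2 ^ t) (psec w v1)"
    using blocks_halve[OF E Suc.prems(1,2) v(4,2)] by simp
  from Suc.IH[OF this _ v(5,3)] show ?case using Suc.prems by (simp add: v(1) path_sec_append)
qed auto

lemma blocks_single:
  assumes "stable_after k (2 ^ t) E" "low (Suc k) w" "length w \<le> 2 ^ t"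
    and "v \<in> lists Z" "length v = Suc (t * Suc E)"
  shows "blocks k 1 (psec w v)"
proof -
  obtain z v' where v: "v = z # v'" using assms(5) by (cases v) auto
  have "blocks k (length w) (sec w z)" using assms v by (intro blocks_initial) auto
  then have "blocks k (2 ^ t) (sec w z)" using assms(3) blocks_mono by blast
  then show ?thesis using blocks_iterate[OF assms(1), of t "sec w z" v'] assms v by auto
qed

section \<open>Stabilisation one level up\<close>

lemma psec_replicate_fixed:
  assumes "sec w x = w" shows "psec w (replicate j x) = w"
  using assms by (induction j) auto

text \<open>If the loop dies within the first \<open>Suc E\<close> letters, the whole section is low
  and E more letters settle it. If it survives, the word before it has already settled to some r,
  and r together with the loop reproduces itself at x with constant output; the word behind the loop
  then reads a constant path and settles in the last E letters.\<close>

lemma stable_after_single: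
  assumes E: "stable_after k n E" and w: "blocks k 1 w" "length w \<le> n" and x: "x \<in> Z"
  shows "sec (psec w (replicate (Suc E + E) x)) x = psec w (replicate (Suc E + E) x)"
proof -
  from w obtain u x0 g u1 where w_eq: "w = u @ g @ u1" and u: "low k u" "low k u1" and g: "loop_at k x0 g"
    by auto
  define R where "R = replicate (Suc E) x"
  have RZ: "R \<in> lists Z" using x by (auto simp: R_def)
  define v1 where "v1 = act u R" 
  define v2 where "v2 = act g v1"
  have vZ: "v1 \<in> lists Z" "v2 \<in> lists Z" using RZ by (auto simp: v1_def v2_def intro!: act_in_lists)
  have s: "psec w R = psec u R @ psec g v1 @ psec u1 v2"
    by (simp add: w_eq path_sec_append_word v1_def v2_def)
  have lows: "low k (psec u R)" "low k (psec u1 v2)" using u vZ RZ by (auto intro!: low_psec)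
  have split: "psec w (replicate (Suc E + E) x) = psec (psec w R) (replicate E x)"
    by (simp only: replicate_add path_sec_append R_def)
  show ?thesis
  proof (cases "v1 = replicate (length v1) x0")
    case False
    then have "low k (psec g v1)" using loop_at_path[OF g vZ(1)] by auto
    then have "low k (psec w R)" using lows s by auto
    then show ?thesis using E x w(2) unfolding split by (auto simp: stable_after_def)
  next
    case True
    then have 1: "psec g v1 = g" "v1 = replicate (Suc E) x0"
      using loop_at_path[OF g vZ(1)] by (auto simp: v1_def R_def)
    define r where "r = psec u (replicate E x)"
    have r: "sec r x = r" using E u x w(2) w_eq by (auto simp: stable_after_def r_def)
    have r': "psec u R = r"
      unfolding R_def by (simp only: replicate_Suc_append path_sec_append) (simp add: r r_def[symmetric])
    have "act u (replicate E x) @ [fold out r x] = replicate E x0 @ [x0]"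
      using 1(2) unfolding v1_def R_def replicate_Suc_append
      by (simp add: word_act_append_path word_act_Cons_letter r_def)
    then have out: "fold out r x = x0" by simp
    define y0 where "y0 = fold out g x0"
    have y0: "y0 \<in> Z" using g by (auto simp: y0_def loop_at_def fold_out_in)
    have fixed: "sec (r @ g) x = r @ g" "fold out (r @ g) x = y0"
      using r out g by (auto simp: word_sec_append loop_at_def y0_def)
    define u' where "u' = psec u1 v2"
    have a: "act (r @ g) (replicate j x) = replicate j y0" for j
      using fixed by (induction j) (auto simp: word_act_Cons_letter simp del: fold_append)
    have "psec ((r @ g) @ u') (replicate E x) = (r @ g) @ psec u' (replicate E y0)"
      by (simp only: path_sec_append_word[of _ _ "r @ g"] a psec_replicate_fixed[OF fixed(1)])
    moreover have "sec (psec u' (replicate E y0)) y0 = psec u' (replicate E y0)"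
      using E y0 lows(2) w(2) w_eq by (auto simp: stable_after_def u'_def)
    ultimately have "sec (psec ((r @ g) @ u') (replicate E x)) x = psec ((r @ g) @ u') (replicate E x)"
      using fixed by (simp only: word_sec_append[of _ _ "r @ g"])
    then show ?thesis unfolding split using s r' 1(1) by (simp add: u'_def)
  qed
qed

text \<open>One letter creates the loops, t rounds of \<open>Suc E\<close> letters reduce at most
  \<open>2 ^ t\<close> of them to one, and \<open>Suc E + E\<close> letters settle the remaining
  case.\<close>

lemma stable_after_Suc:
  assumes "stable_after k (2 ^ t) E"
  shows "stable_after (Suc k) (2 ^ t) (Suc (t * Suc E) + (Suc E + E))"
  unfolding stable_after_def
proof (intro allI impI)
  fix w x assume w: "low (Suc k) w" "length w \<le> 2 ^ t" and x: "x \<in> Z"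
  have "blocks k 1 (psec w (replicate (Suc (t * Suc E)) x))"
    using x by (intro blocks_single[OF assms w]) auto
  from stable_after_single[OF assms this _ x] w(2)
  show "sec (psec w (replicate (Suc (t * Suc E) + (Suc E + E)) x)) x
      = psec w (replicate (Suc (t * Suc E) + (Suc E + E)) x)"
    by (simp only: replicate_add[of "Suc (t * Suc E)"] path_sec_append) simp
qed

lemma sec_trivial_letters:
  assumes "z \<in> Z" "\<forall>s\<in>set w. \<forall>z'\<in>Z. tr s z' = s \<and> out s z' = z'"
  shows "sec w z = w \<and> fold out w z = z"
  using assms by (induction w) auto

lemma sec_low_0:
  assumes "low 0 w" "z \<in> Z" "s \<in> set (sec w z)" "z' \<in> Z"
  shows "tr s z' = s \<and> out s z' = z'"
  using assms
proof (induction w arbitrary: z)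
  case (Cons a w)
  then show ?case using Lo_0[of a z z'] out_bij[of a] by (auto simp: low_Cons bij_betw_def)
qed auto

lemma stable_after_0: "stable_after 0 n 1"
  unfolding stable_after_def
proof (intro allI impI)
  fix w x assume "low 0 w" "x \<in> Z"
  then have "sec (sec w x) x = sec w x"
    using sec_trivial_letters[of x "sec w x"] sec_low_0[of w x] by blast
  then show "sec (psec w (replicate 1 x)) x = psec w (replicate 1 x)" by simp
qed

section \<open>Depth at which nontrivial words are detected\<close>

definition trivial_to :: "nat \<Rightarrow> 's list \<Rightarrow> bool" where
  "trivial_to D w \<longleftrightarrow> (\<forall>v\<in>lists Z. length v \<le> D \<longrightarrow> act w v = v)"

definition detects :: "nat \<Rightarrow> nat \<Rightarrow> nat \<Rightarrow> bool" where
  "detects k n D \<longleftrightarrow> (\<forall>w. low k w \<longrightarrow> length w \<le> n \<longrightarrow> trivial_to D w \<longrightarrow> (\<forall>v\<in>lists Z. act w v = v))"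

lemma trivial_to_psec:
  assumes "trivial_to (a + D) w" "v \<in> lists Z" "length v \<le> a" shows "trivial_to D (psec w v)"
  unfolding trivial_to_def
proof (intro ballI impI)
  fix v' assume "v' \<in> lists Z" "length v' \<le> D"
  with assms have "act w (v @ v') = v @ v'" by (auto simp: trivial_to_def)
  then show "act (psec w v) v' = v'" by (simp add: word_act_append_path)
qed

lemma detects_0: "detects 0 n 1"
  unfolding detects_def
proof (intro allI impI ballI)
  fix w v assume w: "low 0 w" "trivial_to 1 w" and v: "v \<in> lists Z"
  show "act w v = v"
  proof (cases v)
    case (Cons z v')
    have z: "z \<in> Z" "v' \<in> lists Z" using v Cons by auto
    have "act w [z] = [z]" using w z by (auto simp: trivial_to_def)
    then have 1: "fold out w z = z" by (simp add: word_act_Cons_letter)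
    have "act (sec w z) v' = v'"
      using z(2) sec_low_0[OF w(1) z(1)] sec_trivial_letters[of _ "sec w z"]
      by (induction v') (auto simp: word_act_Cons_letter)
    with 1 Cons show ?thesis by (simp add: word_act_Cons_letter)
  qed simp
qed

text \<open>Along x, x, ... the word runs through g followed by the sections of r along y, y, ....
  These stop changing after E letters, so only \<open>Suc E\<close> words occur, and leaving x from
  any of them gives a low word. A depth of E letters to reach such a word, one letter to leave and D
  for the low section therefore decides everything.\<close>

lemma detects_loop:
  assumes E: "stable_after k n E" and D: "detects k n D"
    and g: "loop_at k x g" and r: "low k r" "length (g @ r) \<le> n"
    and triv: "trivial_to (Suc E + D) (g @ r)" and v: "v \<in> lists Z"
  shows "act (g @ r) v = v"
proof -
  define y where "y = fold out g x"
  have x: "x \<in> Z" and gx: "sec g x = g" and low_g: "\<And>z. z \<in> Z \<Longrightarrow> z \<noteq> x \<Longrightarrow> low k (sec g z)"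
    using g by (auto simp: loop_at_def)
  have y: "y \<in> Z" using x by (simp add: y_def fold_out_in)
  define rj where "rj j = psec r (replicate j y)" for j
  have rj_Suc: "rj (Suc j) = sec (rj j) y" for j
    unfolding rj_def replicate_Suc_append path_sec_append by simp
  have E': "rj (Suc E) = rj E" unfolding rj_Suc using E r y by (auto simp: stable_after_def rj_def)
  have low_rj: "low k (rj j)" for j using r y by (auto simp: rj_def intro!: low_psec)
  have "act g (replicate j x) = replicate j y" for j
    using gx by (induction j) (auto simp: word_act_Cons_letter y_def)
  then have path: "psec (g @ r) (replicate j x) = g @ rj j" for j
    by (simp add: path_sec_append_word psec_replicate_fixed gx rj_def)
  have triv_j: "trivial_to (Suc D) (g @ rj j)" if "j \<le> E" for j
  proof -
    have "replicate j x \<in> lists Z" using x by auto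
    then show ?thesis
      using trivial_to_psec[of E "Suc D" "g @ r" "replicate j x"] triv that by (auto simp: path)
  qed
  \<comment> \<open>The induction on v needs all these words at once: reading x passes from index j
    to the next one, and index E passes to itself.\<close>
  have "\<forall>j\<le>E. act (g @ rj j) v = v" using v
  proof (induction v)
    case (Cons z v)
    show ?case
    proof (intro allI impI)
      fix j assume j: "j \<le> E"
      have z: "z \<in> Z" "v \<in> lists Z" using Cons by auto
      have "act (g @ rj j) [z] = [z]" using triv_j[OF j] z by (auto simp: trivial_to_def)
      then have fz: "fold out (g @ rj j) z = z" by (simp add: word_act_Cons_letter)
      have "act (sec (g @ rj j) z) v = v"
      proof (cases "z = x")
        case True
        have "sec (g @ rj j) z = g @ rj (Suc j)"
          by (simp add: True word_sec_append gx rj_Suc y_def)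
        moreover have "act (g @ rj (Suc j)) v = v"
        proof (cases "j = E")
          case True then show ?thesis using Cons E' by auto
        next
          case False then show ?thesis using Cons j by auto
        qed
        ultimately show ?thesis by simp
      next
        case False
        have "low k (sec (g @ rj j) z)"
          using low_g z False low_rj by (auto simp: word_sec_append low_sec fold_out_in)
        moreover have "trivial_to D (sec (g @ rj j) z)"
          using trivial_to_psec[of 1 D "g @ rj j" "[z]"] triv_j[OF j] z by auto
        moreover have "length (sec (g @ rj j) z) \<le> n" using r by (auto simp: rj_def)
        ultimately show ?thesis using D z by (auto simp: detects_def)
      qed
      with fz show "act (g @ rj j) (z # v) = z # v" by (simp add: word_act_Cons_letter)
    qed
  qed auto
  then show ?thesis by (auto dest: spec[of _ 0] simp: rj_def)
qed

text \<open>Conjugating u g u1 by u is a cyclic rotation to g u1 u, which has the same length and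
  needs no inverse word. The action of u permutes the words of each length, so triviality to a given
  depth is transported both ways.\<close>

lemma detects_single:
  assumes E: "stable_after k n E" and D: "detects k n D"
    and w: "blocks k 1 w" "length w \<le> n" and triv: "trivial_to (Suc E + D) w" and v: "v \<in> lists Z"
  shows "act w v = v"
proof -
  from w obtain u x g u1 where w_eq: "w = u @ g @ u1" and u: "low k u" "low k u1" and g: "loop_at k x g"
    by auto
  have conj: "act u (act w v') = act (g @ (u1 @ u)) (act u v')" for v'
    by (simp add: w_eq word_act_append_word)
  have "trivial_to (Suc E + D) (g @ (u1 @ u))"
    unfolding trivial_to_def
  proof (intro ballI impI)
    fix v assume v: "v \<in> lists Z" "length v \<le> Suc E + D"
    obtain v' where v': "v' \<in> lists Z" "length v' = length v" "act u v' = v" using act_surj[OF v(1)] by blast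
    with triv v have "act w v' = v'" by (auto simp: trivial_to_def)
    with conj[of v'] v' show "act (g @ u1 @ u) v = v" by simp
  qed
  moreover have "length (g @ (u1 @ u)) \<le> n" using w w_eq by auto
  ultimately have "act (g @ (u1 @ u)) (act u v) = act u v"
    using u v by (intro detects_loop[OF E D g]) (auto intro!: act_in_lists)
  then show ?thesis using conj[of v] act_inj v act_in_lists by metis
qed

text \<open>A path of length \<open>Suc (t * Suc E)\<close> already leaves at most one loop in its
  section. Such a path is itself covered by the triviality hypothesis, and \<open>Suc E + D\<close>
  letters remain for testing the section.\<close>

lemma detects_Suc:
  assumes E: "stable_after k (2 ^ t) E" and D: "detects k (2 ^ t) D"
  shows "detects (Suc k) (2 ^ t) (Suc (t * Suc E) + (Suc E + D))"
  unfolding detects_def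
proof (intro allI impI ballI)
  fix w v assume w: "low (Suc k) w" "length w \<le> 2 ^ t"
    and triv: "trivial_to (Suc (t * Suc E) + (Suc E + D)) w" and v: "v \<in> lists Z"
  show "act w v = v"
  proof (cases "length v \<le> Suc (t * Suc E)")
    case True with triv v show ?thesis by (auto simp: trivial_to_def)
  next
    case False
    define v1 where "v1 = take (Suc (t * Suc E)) v"
    define v2 where "v2 = drop (Suc (t * Suc E)) v"
    have v12: "v = v1 @ v2" "length v1 = Suc (t * Suc E)" "v1 \<in> lists Z" "v2 \<in> lists Z"
      using v False by (auto simp: v1_def v2_def dest: in_set_takeD in_set_dropD)
    have "act w v1 = v1" using triv v12 by (auto simp: trivial_to_def)
    moreover have "act (psec w v1) v2 = v2"
    proof (rule detects_single[OF E D _ _ _ v12(4)])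
      show "blocks k 1 (psec w v1)" by (rule blocks_single[OF E w v12(3,2)])
      show "trivial_to (Suc E + D) (psec w v1)"
        using triv v12 by (intro trivial_to_psec[where a = "Suc (t * Suc E)"]) auto
    qed (use w in auto)
    ultimately show ?thesis by (simp add: v12(1) word_act_append_path)
  qed
qed

text \<open>Bounding \<open>Suc E\<close> instead of E makes the recursion multiplicative:
  \<open>t * Suc E + 2 * Suc E + 1\<close> is at most \<open>3 * Suc t * Suc E\<close>. The 2 is the
  value of \<open>Suc E\<close> at level 0.\<close>

lemma stable_after_bound: "\<exists>E. stable_after k (2 ^ t) E \<and> Suc E \<le> 2 * (3 * Suc t) ^ k"
proof (induction k)
  case 0
  show ?case using stable_after_0 by (intro exI[of _ 1]) auto
next
  case (Suc k)
  then obtain E where E: "stable_after k (2 ^ t) E" "Suc E \<le> 2 * (3 * Suc t) ^ k" by blast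
  have "Suc (Suc (t * Suc E) + (Suc E + E)) \<le> (3 * Suc t) * Suc E" by (simp add: algebra_simps)
  also have "\<dots> \<le> (3 * Suc t) * (2 * (3 * Suc t) ^ k)" using E(2) by (intro mult_le_mono) auto
  finally show ?case using stable_after_Suc[OF E(1)] by (auto simp: mult.left_commute)
qed

text \<open>Passing to the next level adds only one D to \<open>Suc t\<close> copies of
  \<open>Suc E\<close> and one letter, so the recursion is governed by the growth of E and the same
  bound works for both.\<close>

lemma detects_bound: "\<exists>D. detects k (2 ^ t) D \<and> D \<le> 2 * (3 * Suc t) ^ k"
proof (induction k)
  case 0
  show ?case using detects_0 by (intro exI[of _ 1]) auto
next
  case (Suc k)
  then obtain D where D: "detects k (2 ^ t) D" "D \<le> 2 * (3 * Suc t) ^ k" by blast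
  obtain E where E: "stable_after k (2 ^ t) E" "Suc E \<le> 2 * (3 * Suc t) ^ k"
    using stable_after_bound by blast
  have "Suc (t * Suc E) + (Suc E + D) \<le> Suc (t * (2 * (3 * Suc t) ^ k)) + (2 * (3 * Suc t) ^ k + 2 * (3 * Suc t) ^ k)"
    using D(2) E(2) by (intro add_mono Suc_le_mono[THEN iffD2] mult_le_mono) auto
  also have "\<dots> \<le> (3 * Suc t) * (2 * (3 * Suc t) ^ k)"
  proof -
    have "1 \<le> (3 * Suc t) ^ k" by simp
    moreover define M where "M = (3 * Suc t) ^ k"
    ultimately show ?thesis unfolding M_def[symmetric] by (simp add: algebra_simps)
  qed
  finally show ?case using detects_Suc[OF E(1) D(1)] by (auto simp: mult.left_commute)
qed

end

section \<open>Growth of polynomial automata\<close>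

text \<open>With \<open>B\<close> the set of trivial states this is the activity growth of the
  automaton. The set is a parameter because the degree is analysed with the finitary states in its
  place.\<close>

fun escape_count :: "('s \<Rightarrow> 'x::finite \<Rightarrow> 's) \<Rightarrow> 's set \<Rightarrow> 's \<Rightarrow> nat \<Rightarrow> nat" where
  "escape_count tr B s 0 = (if s \<in> B then 0 else 1)"
| "escape_count tr B s (Suc n) = (\<Sum>x\<in>UNIV. escape_count tr B (tr s x) n)"

lemma aut_tr_Nil [simp]: "aut_tr tr s [] = s"
  and aut_tr_Cons [simp]: "aut_tr tr s (x # v) = aut_tr tr (tr s x) v"
  and aut_tr_append: "aut_tr tr s (v @ v') = aut_tr tr (aut_tr tr s v) v'"
  by (simp_all add: aut_tr_def)

lemma finite_lists_length [simp]: "finite {v :: 'x::finite list. length v = n}"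
  using finite_lists_length_eq[of "UNIV :: 'x set" n] by simp

lemma sum_lists_Suc:
  fixes f :: "'x::finite list \<Rightarrow> nat"
  shows "(\<Sum>v | length v = Suc n. f v) = (\<Sum>x\<in>UNIV. \<Sum>v | length v = n. f (x # v))"
proof -
  have "{v :: 'x list. length v = Suc n} = (\<lambda>(x, v). x # v) ` (UNIV \<times> {v. length v = n})"
    by (auto simp: image_iff length_Suc_conv)
  moreover have "inj_on (\<lambda>(x, v). x # v) (UNIV \<times> {v :: 'x list. length v = n})"
    by (auto simp: inj_on_def)
  ultimately have "(\<Sum>v | length v = Suc n. f v) = (\<Sum>(x, v)\<in>UNIV \<times> {v. length v = n}. f (x # v))"
    by (simp only: sum.reindex) (simp add: comp_def case_prod_beta)
  then show ?thesis by (simp add: sum.cartesian_product)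
qed

lemma escape_count_add:
  "escape_count tr B s (m + n) = (\<Sum>v | length v = m. escape_count tr B (aut_tr tr s v) n)"
proof (induction m arbitrary: s)
  case 0
  have "{v :: 'b list. length v = 0} = {[]}" by auto
  then show ?case by simp
qed (simp add: sum_lists_Suc)

lemma escape_count_eq_card:
  "escape_count tr B s n = card {v. length v = n \<and> aut_tr tr s v \<notin> B}"
proof -
  have "escape_count tr B s n = (\<Sum>v | length v = n. if aut_tr tr s v \<notin> B then 1 else 0)"
    using escape_count_add[of tr B s n 0] by (simp add: if_distrib cong: if_cong) (auto intro!: sum.cong)
  also have "\<dots> = card ({v. length v = n} \<inter> {v. aut_tr tr s v \<notin> B})"
    using sum.inter_restrict[of "{v. length v = n}" "\<lambda>v. 1::nat" "{v. aut_tr tr s v \<notin> B}"] by simp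
  also have "{v. length v = n} \<inter> {v. aut_tr tr s v \<notin> B} = {v. length v = n \<and> aut_tr tr s v \<notin> B}"
    by auto
  finally show ?thesis .
qed

lemma escape_count_eq_0_iff:
  "escape_count tr B s n = 0 \<longleftrightarrow> (\<forall>v. length v = n \<longrightarrow> aut_tr tr s v \<in> B)"
  unfolding escape_count_eq_card by (subst card_0_eq) (auto intro: finite_subset[OF _ finite_lists_length])

lemma escape_count_antimono: "B \<subseteq> B' \<Longrightarrow> escape_count tr B' s n \<le> escape_count tr B s n"
  unfolding escape_count_eq_card by (intro card_mono) (auto intro: finite_subset[OF _ finite_lists_length])

lemma split_into_blocks: "length u = m * j \<Longrightarrow> \<exists>vs\<in>lists {v. length v = m}. concat vs = u"
proof (induction j arbitrary: u)
  case 0 then show ?case by (intro bexI[of _ "[]"]) auto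
next
  case (Suc j)
  from Suc.prems have "length (drop m u) = m * j" by simp
  from Suc.IH[OF this] obtain vs where "vs \<in> lists {v. length v = m}" "concat vs = drop m u" by blast
  with Suc show ?case by (intro bexI[of _ "take m u # vs"]) auto
qed

lemma fold_aut_out: "fold (aut_out tr out) w v = word_act tr out w v"
  by (induction w arbitrary: v) auto

text \<open>The automaton over the alphabet of words has \<open>aut_tr\<close> and
  \<open>aut_out\<close> as its transition and output maps. Its one-letter sections are sections
  along paths of the original automaton, which lets the analysis of loops be applied to blocks of
  letters.\<close>

lemma word_sec_aut_tr: "word_sec (aut_tr tr) (aut_out tr out) w v = path_sec tr out w v"
proof (induction w arbitrary: v)
  case (Cons s w)
  have "path_sec tr out (s # w) v = aut_tr tr s v # path_sec tr out w (aut_out tr out s v)" for s w v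
    by (induction v arbitrary: s w) auto
  with Cons show ?case by simp
qed simp

lemma concat_word_act_aut_tr:
  "concat (word_act (aut_tr tr) (aut_out tr out) w vs) = word_act tr out w (concat vs)"
  by (induction vs arbitrary: w)
    (auto simp: word_act_Cons_letter word_act_append_path fold_aut_out word_sec_aut_tr)

text \<open>The powers of \<open>Suc n\<close> instead of n keep the bound meaningful at n = 0 and
  let a single constant absorb all lower terms of the growth polynomial.\<close>

locale polynomial_automaton =
  fixes trn :: "'s::finite \<Rightarrow> 'x::finite \<Rightarrow> 's" and otp :: "'s \<Rightarrow> 'x \<Rightarrow> 'x" and Cd d :: nat
  assumes otp_bij: "bij (otp s)"
    and minimal: "inj (aut_out trn otp)"
    and growth: "escape_count trn {s. aut_out trn otp s = id} s n \<le> Cd * Suc n ^ d"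
begin

section \<open>Finitary states and the filtration by growth\<close>

definition Triv :: "'s set" where "Triv = {s. aut_out trn otp s = id}"

definition Fin :: "'s set" where "Fin = {s. \<exists>n. escape_count trn Triv s n = 0}"

abbreviation "tr \<equiv> aut_tr trn"

text \<open>Counting sections outside \<open>Fin\<close> makes the count monotone in the length: a
  state outside \<open>Fin\<close> has such a section at some letter, whereas a nontrivial finitary
  state may have only trivial sections.\<close>

abbreviation "g \<equiv> escape_count trn Fin"

text \<open>The index is the degree plus one, so that finitary states can start the induction at
  0.\<close>

fun lev :: "nat \<Rightarrow> 's set" where
  "lev 0 = Fin"
| "lev (Suc k) = {s. \<exists>C. \<forall>n. g s n \<le> C * Suc n ^ k}"

text \<open>Sections of the identity act as the identity; minimality turns this equality of actions
  into an equality of states.\<close>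

lemma Triv_letter: "s \<in> Triv \<Longrightarrow> trn s x = s \<and> otp s x = x"
proof -
  assume "s \<in> Triv"
  then have s: "aut_out trn otp s v = v" for v by (simp add: Triv_def)
  from s[of "[x]"] have "otp s x = x" by simp
  moreover have "aut_out trn otp (trn s x) = aut_out trn otp s"
  proof
    fix v show "aut_out trn otp (trn s x) v = aut_out trn otp s v" using s[of "x # v"] s[of v] by simp
  qed
  ultimately show ?thesis using minimal by (auto dest: injD)
qed

lemma Triv_tr: "s \<in> Triv \<Longrightarrow> tr s v = s"
  by (induction v) (auto simp: Triv_letter)

lemma Fin_iff: "s \<in> Fin \<longleftrightarrow> (\<exists>n. \<forall>v. length v \<ge> n \<longrightarrow> tr s v \<in> Triv)"
proof
  assume "s \<in> Fin"
  then obtain n where n: "\<And>v. length v = n \<Longrightarrow> tr s v \<in> Triv"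
    by (auto simp: Fin_def escape_count_eq_0_iff)
  have "tr s v \<in> Triv" if "length v \<ge> n" for v
  proof -
    have "tr s (take n v) \<in> Triv" using that by (intro n) auto
    then show ?thesis using aut_tr_append[of trn s "take n v" "drop n v"] by (simp add: Triv_tr)
  qed
  then show "\<exists>n. \<forall>v. length v \<ge> n \<longrightarrow> tr s v \<in> Triv" by blast
next
  assume "\<exists>n. \<forall>v. length v \<ge> n \<longrightarrow> tr s v \<in> Triv"
  then obtain n where "\<forall>v. length v = n \<longrightarrow> tr s v \<in> Triv" by (metis order_refl)
  then show "s \<in> Fin" unfolding Fin_def escape_count_eq_0_iff by blast
qed

lemma Triv_subset_Fin: "Triv \<subseteq> Fin"
  by (auto simp: Fin_iff Triv_tr)

lemma Fin_depth: "\<exists>D. \<forall>s\<in>Fin. \<forall>v. length v \<ge> D \<longrightarrow> tr s v \<in> Triv"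
proof -
  obtain f where f: "\<And>s v. s \<in> Fin \<Longrightarrow> length v \<ge> f s \<Longrightarrow> tr s v \<in> Triv"
    using Fin_iff by metis
  have "f s \<le> Max (range f)" for s by (intro Max_ge) auto
  then show ?thesis using f by (intro exI[of _ "Max (range f)"]) (meson le_trans)
qed

lemma Fin_letter: "s \<in> Fin \<Longrightarrow> trn s x \<in> Fin"
proof -
  assume "s \<in> Fin"
  then obtain n where "\<And>v. length v \<ge> n \<Longrightarrow> tr s v \<in> Triv" by (auto simp: Fin_iff)
  then have "\<forall>v. length v \<ge> n \<longrightarrow> tr (trn s x) v \<in> Triv"
    by (metis aut_tr_Cons le_SucI length_Cons)
  then show ?thesis by (auto simp: Fin_iff)
qed

lemma Fin_if_letters: assumes "\<And>x. trn s x \<in> Fin" shows "s \<in> Fin"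
proof -
  obtain D where D: "\<And>s v. s \<in> Fin \<Longrightarrow> length v \<ge> D \<Longrightarrow> tr s v \<in> Triv" using Fin_depth by blast
  have "tr s v \<in> Triv" if "length v \<ge> Suc D" for v
    using that assms D by (cases v) auto
  then show ?thesis by (auto simp: Fin_iff)
qed

lemma g_mono_Suc: "g s n \<le> g s (Suc n)"
proof (induction n arbitrary: s)
  case 0
  show ?case
  proof (cases "s \<in> Fin")
    case False
    then obtain x where "trn s x \<notin> Fin" using Fin_if_letters by blast
    then have "1 \<le> g (trn s x) 0" by simp
    also have "\<dots> \<le> (\<Sum>x\<in>UNIV. g (trn s x) 0)"
      by (rule member_le_sum[of x UNIV "\<lambda>x. g (trn s x) 0"]) auto
    finally show ?thesis using False by simp
  qed simp
next
  case (Suc n)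
  have "(\<Sum>x\<in>UNIV. g (trn s x) n) \<le> (\<Sum>x\<in>UNIV. g (trn s x) (Suc n))" using Suc by (rule sum_mono)
  then show ?case by simp
qed

lemma g_mono: "m \<le> n \<Longrightarrow> g s m \<le> g s n"
  using g_mono_Suc by (rule lift_Suc_mono_le)

lemma g_tr_le: "g (tr s v) n \<le> g s (length v + n)"
  unfolding escape_count_add by (rule member_le_sum[of v _ "\<lambda>v. g (tr s v) n"]) auto

lemma lev_letter: "s \<in> lev k \<Longrightarrow> trn s x \<in> lev k"
proof (induction k)
  case (Suc k)
  then obtain C where C: "\<And>n. g s n \<le> C * Suc n ^ k" by auto
  have "g (trn s x) n \<le> (C * 2 ^ k) * Suc n ^ k" for n
  proof -
    have "g (trn s x) n \<le> g s (Suc n)" using g_tr_le[of s "[x]" n] by simp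
    also have "\<dots> \<le> C * Suc (Suc n) ^ k" by (rule C)
    also have "\<dots> \<le> C * (2 * Suc n) ^ k" by (intro mult_le_mono power_mono) auto
    also have "\<dots> = (C * 2 ^ k) * Suc n ^ k" by (simp only: power_mult_distrib mult.assoc)
    finally show ?thesis .
  qed
  then show ?case by auto
qed (auto simp: Fin_letter)

lemma lev_tr: "s \<in> lev k \<Longrightarrow> tr s v \<in> lev k"
  by (induction v arbitrary: s) (auto simp: lev_letter simp del: lev.simps)

lemma lev_if_letters: assumes "\<And>x. trn s x \<in> lev k" shows "s \<in> lev k"
proof (cases k)
  case 0
  with assms show ?thesis using Fin_if_letters by simp
next
  case (Suc k)
  with assms obtain C where C: "\<And>x n. g (trn s x) n \<le> C x * Suc n ^ k" by simp metis
  have "g s n \<le> (\<Sum>x\<in>UNIV. C x) * Suc n ^ k" for n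
  proof -
    have "g s n \<le> g s (Suc n)" by (rule g_mono_Suc)
    also have "\<dots> = (\<Sum>x\<in>UNIV. g (trn s x) n)" by simp
    also have "\<dots> \<le> (\<Sum>x\<in>UNIV. C x * Suc n ^ k)" by (intro sum_mono C)
    finally show ?thesis by (simp add: sum_distrib_right)
  qed
  with Suc show ?thesis by auto
qed

lemma lev_if_sections: assumes "\<And>z. length z = i \<Longrightarrow> tr s z \<in> lev k" shows "s \<in> lev k"
  using assms
proof (induction i arbitrary: s)
  case 0
  then show ?case using 0[of "[]"] by simp
next
  case (Suc i)
  have "trn s x \<in> lev k" for x
  proof (rule Suc.IH)
    fix z :: "'x list" assume "length z = i"
    then show "tr (trn s x) z \<in> lev k" using Suc.prems[of "x # z"] by simp
  qed
  then show ?case by (rule lev_if_letters)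
qed

text \<open>Each turn around a cycle leaves along \<open>u\<close> once, so the growth of \<open>tr p u\<close> is summed.\<close>

lemma loop_other_section:
  assumes p: "p \<in> lev (Suc k)" and c: "tr p c = p" "length c = m"
    and u: "length u = m" "u \<noteq> c"
  shows "tr p u \<in> lev k"
proof -
  define q where "q = tr p u"
  \<comment> \<open>The two words c and u of length m are distinct, so their contributions to the
    sum over all words of length m are disjoint.\<close>
  have step: "g p (m + n) \<ge> g p n + g q n" for n
  proof -
    have "g p n + g q n = (\<Sum>v\<in>{c, u}. g (tr p v) n)" using u c by (simp add: q_def)
    also have "\<dots> \<le> (\<Sum>v | length v = m. g (tr p v) n)" using u c by (intro sum_mono2) auto
    finally show ?thesis by (simp add: escape_count_add)
  qed
  have iter: "j * g q n \<le> g p (j * m + n)" for j n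
  proof (induction j)
    case (Suc j)
    have "Suc j * g q n \<le> g p (j * m + n) + g q (j * m + n)"
      using Suc g_mono[of n "j * m + n" q] by simp
    also have "\<dots> \<le> g p (Suc j * m + n)" using step[of "j * m + n"] by (simp add: add.assoc)
    finally show ?case .
  qed simp
  obtain C where C: "\<And>n. g p n \<le> C * Suc n ^ k" using p by auto
  show ?thesis
  proof (cases k)
    case 0
    \<comment> \<open>For degree 0 the bound does not depend on the number j of turns, so nothing
      can be lost at u.\<close>
    have "j * g q 0 \<le> C" for j using iter[of j 0] C[of "j * m"] 0 by simp
    from this[of "Suc C"] have "g q 0 = 0" by (cases "g q 0") auto
    then have "q \<in> Fin" by (simp split: if_splits)
    with 0 show ?thesis by (simp add: q_def)
  next
    case (Suc l)
    have "g q n \<le> (C * Suc m ^ k) * Suc n ^ l" for n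
    proof -
      \<comment> \<open>Taking \<open>Suc n\<close> turns yields a factor \<open>Suc n\<close> on
        the left while the argument on the right stays linear in n; cancelling it lowers the degree
        by one.\<close>
      have "Suc n * g q n \<le> C * Suc (Suc n * m + n) ^ k" using iter[of "Suc n" n] C le_trans by blast
      also have "Suc (Suc n * m + n) = Suc m * Suc n" by simp
      also have "C * (Suc m * Suc n) ^ k = Suc n * ((C * Suc m ^ k) * Suc n ^ l)"
        unfolding Suc by (simp only: power_mult_distrib power_Suc ac_simps)
      finally show ?thesis by (simp only: Suc_mult_le_cancel1)
    qed
    with Suc show ?thesis by (auto simp: q_def)
  qed
qed

text \<open>Along v some state p is visited twice, and its cycle unrolls to a word c of length m
  because every cycle length divides m. If the rest u of v follows that cycle, the end point lies on
  it and is a loop for a rotation of c. Otherwise every extension of u to length m differs from c,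
  so \<open>loop_other_section\<close> puts all these sections one level lower, and
  \<open>lev_if_sections\<close> lifts this back to the end point.\<close>

lemma lev_Suc_section:
  assumes s: "s \<in> lev (Suc k)" and v: "length v = m"
    and m: "card (UNIV :: 's set) \<le> m" "\<And>l. 0 < l \<Longrightarrow> l \<le> card (UNIV :: 's set) \<Longrightarrow> l dvd m"
  shows "tr s v \<in> lev k \<or> (\<exists>x. length x = m \<and> tr (tr s v) x = tr s v \<and>
    (\<forall>z. length z = m \<longrightarrow> z \<noteq> x \<longrightarrow> tr (tr s v) z \<in> lev k))"
proof -
  define f where "f i = tr s (take i v)" for i
  have "\<not> inj_on f {..card (UNIV :: 's set)}"
  proof
    assume "inj_on f {..card (UNIV :: 's set)}"
    then have "card {..card (UNIV :: 's set)} \<le> card (UNIV :: 's set)"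
      by (metis card_image card_mono finite_UNIV subset_UNIV finite)
    then show False by simp
  qed
  then obtain i j where ij: "i < j" "j \<le> card (UNIV :: 's set)" "f i = f j"
    unfolding inj_on_def by (metis atMost_iff linorder_neqE_nat)
  define p where "p = f i"
  define c0 where "c0 = take (j - i) (drop i v)"
  have len0: "length c0 = j - i" using ij v m by (simp add: c0_def)
  have "take j v = take i v @ c0" using ij by (simp add: c0_def take_add[symmetric])
  then have "tr p c0 = f j" by (simp add: p_def f_def aut_tr_append)
  then have c0: "tr p c0 = p" using ij by (simp add: p_def)
  define c where "c = concat (replicate (m div (j - i)) c0)"
  have "tr p (concat (replicate h c0)) = p" for h by (induction h) (auto simp: aut_tr_append c0)
  then have c: "tr p c = p" by (simp add: c_def)
  have "(j - i) dvd m" using ij by (intro m(2)) auto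
  then have lenc: "length c = m" by (simp add: c_def length_concat sum_list_replicate len0)
  define u where "u = drop i v"
  have lenu: "length u = m - i" using v by (simp add: u_def)
  have im: "i \<le> m" using ij m by simp
  have sv: "tr s v = tr p u" by (simp add: p_def f_def u_def aut_tr_append[symmetric])
  have p: "p \<in> lev (Suc k)" using s lev_tr by (simp add: p_def f_def del: lev.simps)
  show ?thesis
  proof (cases "\<exists>b. c = u @ b")
    case True
    then obtain b where b: "c = u @ b" by blast
    have "tr (tr p u) b = p" using c b by (simp add: aut_tr_append[symmetric])
    then have loop: "tr (tr p u) (b @ u) = tr p u" by (simp add: aut_tr_append)
    have len: "length (b @ u) = m" using lenc b by simp
    have "tr p u \<in> lev (Suc k)" using p by (rule lev_tr)
    then have "\<forall>z. length z = m \<longrightarrow> z \<noteq> b @ u \<longrightarrow> tr (tr p u) z \<in> lev k"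
      using loop_other_section[OF _ loop len] by blast
    then show ?thesis using loop len unfolding sv by blast
  next
    case False
    have "tr (tr p u) z \<in> lev k" if z: "length z = i" for z
    proof -
      have "u @ z \<noteq> c" using False by auto
      then have "tr p (u @ z) \<in> lev k"
        using z lenu im by (intro loop_other_section[OF p c lenc]) auto
      then show ?thesis by (simp add: aut_tr_append)
    qed
    then show ?thesis using lev_if_sections sv by metis
  qed
qed

section \<open>Detection depth over the original alphabet\<close>

lemma aut_out_bij: "bij_betw (aut_out trn otp s) {v. length v = m} {v. length v = m}"
proof -
  have "v = v'" if "aut_out trn otp s v = aut_out trn otp s v'" for s v v'
    using that
  proof (induction v arbitrary: s v')
    case Nil then show ?case by (metis length_0_conv length_aut_out)
  next
    case (Cons x v)
    then obtain x' u where v': "v' = x' # u" by (cases v') auto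
    with Cons.prems have "otp s x = otp s x'" "aut_out trn otp (trn s x) v = aut_out trn otp (trn s x') u"
      by auto
    with Cons.IH v' show ?case using otp_bij[of s] by (metis bij_is_inj injD)
  qed
  then have "inj_on (aut_out trn otp s) {v. length v = m}" by (auto simp: inj_on_def)
  moreover have "aut_out trn otp s ` {v. length v = m} = {v. length v = m}"
    by (intro endo_inj_surj calculation finite_lists_length) auto
  ultimately show ?thesis by (simp add: bij_betw_def)
qed

lemma lev_degree: "lev (Suc d) = UNIV"
proof -
  have "g s n \<le> Cd * Suc n ^ d" for s n
    using escape_count_antimono[OF Triv_subset_Fin, of trn s n] growth[of s n]
    by (simp add: Triv_def)
  then show ?thesis by auto
qed

theorem detection_depth:
  "\<exists>C. \<forall>w t. length w \<le> 2 ^ t \<longrightarrow>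
     (\<forall>v. length v = C * Suc t ^ Suc d \<longrightarrow> word_act trn otp w v = v) \<longrightarrow> word_act trn otp w = id"
proof -
  obtain D0 where D0: "\<And>s v. s \<in> Fin \<Longrightarrow> length v \<ge> D0 \<Longrightarrow> tr s v \<in> Triv" using Fin_depth by blast
  \<comment> \<open>The factorial makes m divisible by every cycle length and at least the number of
    states; the factor \<open>Suc D0\<close> makes one letter of \<open>Z\<close> long enough to
    turn every finitary state into a trivial one.\<close>
  define m where "m = fact (card (UNIV :: 's set)) * Suc D0"
  have f1: "(1::nat) \<le> fact n" for n by (simp add: Suc_le_eq)
  have "card (UNIV :: 's set) * 1 \<le> m" unfolding m_def by (intro mult_le_mono fact_ge_self) auto
  then have m1: "card (UNIV :: 's set) \<le> m" by simp
  have "1 * D0 \<le> m" unfolding m_def using f1 by (intro mult_le_mono) auto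
  then have m2: "D0 \<le> m" by simp
  have m3: "0 < m" by (simp add: m_def)
  have m4: "l dvd m" if "0 < l" "l \<le> card (UNIV :: 's set)" for l
    unfolding m_def using that by (intro dvd_mult2 dvd_fact) auto
  define Z where "Z = {v :: 'x list. length v = m}"
  interpret F: loop_filtration "aut_tr trn" "aut_out trn otp" Z lev
  proof
    show "bij_betw (aut_out trn otp s) Z Z" for s unfolding Z_def by (rule aut_out_bij)
    show "Z \<noteq> {}" using length_replicate[of m undefined] unfolding Z_def by blast
    show "tr s z \<in> lev k" if "s \<in> lev k" "z \<in> Z" for s k z using that(1) by (rule lev_tr)
    show "tr (tr s z) z' = tr s z \<and> aut_out trn otp (tr s z) z' = z'"
      if "s \<in> lev 0" "z \<in> Z" "z' \<in> Z" for s z z'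
    proof -
      have "tr s z \<in> Triv" using that m2 by (intro D0) (auto simp: Z_def)
      then show ?thesis using Triv_tr by (auto simp: Triv_def)
    qed
    show "tr s z \<in> lev k \<or> (\<exists>x\<in>Z. tr (tr s z) x = tr s z \<and> (\<forall>z'\<in>Z - {x}. tr (tr s z) z' \<in> lev k))"
      if "s \<in> lev (Suc k)" "z \<in> Z" for s k z
      using lev_Suc_section[OF that(1) _ m1 m4, of z] that(2) unfolding Z_def by blast
  qed
  have main: "word_act trn otp w = id"
    if w: "length w \<le> 2 ^ t" and triv: "\<forall>v. length v = m * 2 * 3 ^ Suc d * Suc t ^ Suc d \<longrightarrow> word_act trn otp w v = v"
    for w t
  proof
    fix v :: "'x list"
    obtain D where D: "F.detects (Suc d) (2 ^ t) D" "D \<le> 2 * (3 * Suc t) ^ Suc d"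
      using F.detects_bound by blast
    have "m * D \<le> m * (2 * (3 * Suc t) ^ Suc d)" using D(2) by simp
    also have "\<dots> = m * 2 * 3 ^ Suc d * Suc t ^ Suc d" by (simp only: power_mult_distrib ac_simps)
    finally have mD: "m * D \<le> m * 2 * 3 ^ Suc d * Suc t ^ Suc d" .
    have "F.trivial_to D w"
      unfolding F.trivial_to_def
    proof (intro ballI impI)
      fix vs assume vs: "vs \<in> lists Z" "length vs \<le> D"
      have "length (concat vs) = m * length vs"
        using vs(1) by (induction vs) (auto simp: Z_def)
      also have "\<dots> \<le> m * D" using vs(2) by simp
      finally have "word_act trn otp w (concat vs) = concat vs"
        using mD by (intro word_act_extend_prefix[OF triv]) (rule le_trans)
      then have eq: "concat (F.act w vs) = concat vs" by (simp add: concat_word_act_aut_tr)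
      have "F.act w vs \<in> lists Z" using vs(1) by (rule F.act_in_lists)
      then show "F.act w vs = vs"
        using eq vs(1) by (intro concat_injective) (auto simp: Z_def, metis set_zip_leftD set_zip_rightD)
    qed
    moreover have "F.low (Suc d) w" using lev_degree by (auto simp: F.low_def)
    ultimately have triv': "\<And>vs. vs \<in> lists Z \<Longrightarrow> F.act w vs = vs"
      using D(1) w by (auto simp: F.detects_def)
    \<comment> \<open>Since m is positive, v can be padded to length \<open>m * length v\<close>,
      which splits into letters of \<open>Z\<close>; the padding is cut off again at the
      end.\<close>
    obtain vs where vs: "vs \<in> lists Z" "concat vs = v @ replicate (m * length v - length v) undefined"
    proof -
      have "length (v @ replicate (m * length v - length v) undefined) = m * length v"
        using m3 by simp
      from split_into_blocks[OF this] that show ?thesis unfolding Z_def by blast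
    qed
    have "word_act trn otp w (concat vs) = concat vs"
      using triv'[OF vs(1)] concat_word_act_aut_tr by metis
    then show "word_act trn otp w v = id v" unfolding vs(2) by (simp add: word_act_append_path)
  qed
  then show ?thesis by (intro exI[of _ "m * 2 * 3 ^ Suc d"]) blast
qed

end

section \<open>Contracting automata\<close>

lemma word_len_le: "word_act tr out u = word_act tr out w \<Longrightarrow> word_len tr out w \<le> length u"
  unfolding word_len_def by (rule Least_le) auto

lemma word_len_witness:
  obtains u where "length u = word_len tr out w" "word_act tr out u = word_act tr out w"
proof -
  have "\<exists>u. length u = word_len tr out w \<and> word_act tr out u = word_act tr out w"
    unfolding word_len_def by (rule LeastI[of _ "length w"]) blast
  then show thesis using that by blast
qed

lemma word_len_cong: "word_act tr out w = word_act tr out w' \<Longrightarrow> word_len tr out w = word_len tr out w'"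
  by (simp add: word_len_def)

lemma word_act_sec_cong:
  assumes "word_act tr out w = word_act tr out w'"
  shows "word_act tr out (word_sec tr out w x) = word_act tr out (word_sec tr out w' x)"
proof
  fix v
  from assms have "word_act tr out w (x # v) = word_act tr out w' (x # v)" by simp
  then show "word_act tr out (word_sec tr out w x) v = word_act tr out (word_sec tr out w' x) v"
    by (simp add: word_act_Cons_letter)
qed

lemma word_len_append: "word_len tr out (u @ w) \<le> word_len tr out u + word_len tr out w"
proof -
  obtain u' where u': "length u' = word_len tr out u" "word_act tr out u' = word_act tr out u"
    by (rule word_len_witness)
  obtain w' where w': "length w' = word_len tr out w" "word_act tr out w' = word_act tr out w"
    by (rule word_len_witness)
  have "word_act tr out (u' @ w') = word_act tr out (u @ w)"
    using u'(2) w'(2) by (auto simp: word_act_append_word)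
  from word_len_le[OF this] u' w' show ?thesis by simp
qed

context
  fixes tr :: "'s::finite \<Rightarrow> 'x \<Rightarrow> 's" and out :: "'s \<Rightarrow> 'x \<Rightarrow> 'x" and N :: nat
  assumes N: "2 \<le> N"
    and contr: "\<And>w x. N \<le> length w \<Longrightarrow> word_len tr out (word_sec tr out w x) < length w"
begin

text \<open>The word is cut into factors of length N; by contraction the section of each of the
  \<open>length u div N\<close> full factors can be shortened by at least one letter.\<close>

lemma word_len_sec_le: "word_len tr out (word_sec tr out u x) \<le> length u - length u div N"
proof (induction "length u" arbitrary: u x rule: less_induct)
  case less
  show ?case
  proof (cases "length u < N")
    case True
    then show ?thesis using word_len_le[of tr out "word_sec tr out u x" "word_sec tr out u x"] by simp
  next
    case False
    define a where "a = take N u"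
    define b where "b = drop N u"
    have u: "u = a @ b" "length a = N" using False by (auto simp: a_def b_def)
    let ?b = "word_sec tr out b (fold out a x)"
    have "word_len tr out (word_sec tr out u x) \<le> word_len tr out (word_sec tr out a x) + word_len tr out ?b"
      unfolding u(1) word_sec_append by (rule word_len_append)
    also have "word_len tr out (word_sec tr out a x) \<le> N - 1" using contr[of a x] u by simp
    also have "word_len tr out ?b \<le> length b - length b div N"
      using u N by (intro less.hyps) auto
    also have "N - 1 + (length b - length b div N) = length u - length u div N"
    proof -
      have "length u div N = Suc (length b div N)" using u N by simp
      moreover have "length b div N \<le> length b" by simp
      ultimately show ?thesis using u N by simp
    qed
    finally show ?thesis by simp
  qed
qed

text \<open>The action of a section depends only on the action of the word, so w may be replaced by
  a shortest representative before the factors are cut.\<close>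

lemma word_len_sec_shrinks:
  "word_len tr out (word_sec tr out w x) \<le> word_len tr out w - word_len tr out w div N"
proof -
  obtain u where u: "length u = word_len tr out w" "word_act tr out u = word_act tr out w"
    by (rule word_len_witness)
  have "word_len tr out (word_sec tr out w x) = word_len tr out (word_sec tr out u x)"
    using u(2) by (intro word_len_cong word_act_sec_cong) simp
  with word_len_sec_le[of u x] u(1) show ?thesis by simp
qed

text \<open>While the length L is at least N, rounding costs at most a factor two, so each letter
  removes L div N >= L / (2N) letters. While L also exceeds \<open>2 ^ t\<close>, 2N steps remove
  \<open>2 ^ t\<close> in total. Below N the rounding destroys the gain, hence the second
  alternative.\<close>

lemma word_len_path_halves:
  assumes "word_len tr out w \<le> 2 ^ Suc t" "length v = 2 * N"
  shows "word_len tr out (path_sec tr out w v) \<le> 2 ^ t \<or> word_len tr out (path_sec tr out w v) < N"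
proof -
  have "2 * N * word_len tr out (path_sec tr out w v) + length v * 2 ^ t \<le> 2 * N * 2 ^ Suc t
    \<or> word_len tr out (path_sec tr out w v) \<le> 2 ^ t \<or> word_len tr out (path_sec tr out w v) < N"
  proof (induction v rule: rev_induct)
    case Nil
    then show ?case using assms by simp
  next
    case (snoc x v)
    define L where "L = word_len tr out (path_sec tr out w v)"
    define L' where "L' = word_len tr out (path_sec tr out w (v @ [x]))"
    have L': "L' \<le> L - L div N"
      using word_len_sec_shrinks[of "path_sec tr out w v" x] by (simp add: L_def L'_def path_sec_append)
    show ?case
    proof (cases "L \<le> 2 ^ t \<or> L < N")
      case True
      then show ?thesis using L' unfolding L'_def[symmetric] by linarith
    next
      case False
      then have IH: "2 * N * L + length v * 2 ^ t \<le> 2 * N * 2 ^ Suc t" using snoc by (simp add: L_def)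
      have "1 \<le> L div N" using False N by (simp add: div_greater_zero_iff Suc_le_eq)
      moreover have "L = N * (L div N) + L mod N" by simp
      moreover have "L mod N < N" using N by simp
      moreover have "N * 1 \<le> N * (L div N)" using calculation by (intro mult_le_mono) auto
      ultimately have "L \<le> 2 * (N * (L div N))" by linarith
      moreover have "2 * N * L' \<le> 2 * N * L - 2 * N * (L div N)"
        using mult_le_mono2[OF L', of "2 * N"] by (simp add: diff_mult_distrib2)
      moreover have "2 ^ t \<le> L" using False by simp
      moreover have "2 * N * (L div N) \<le> 2 * N * L" by (intro mult_le_mono) auto
      ultimately have "2 * N * L' + 2 ^ t \<le> 2 * N * L" by linarith
      with IH have "2 * N * L' + length (v @ [x]) * 2 ^ t \<le> 2 * N * 2 ^ Suc t" by simp
      then show ?thesis by (simp add: L'_def)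
    qed
  qed
  then show ?thesis using assms(2) N by (auto simp: mult_le_cancel1)
qed

lemma word_len_path_antimono: "word_len tr out (path_sec tr out w v) \<le> word_len tr out w"
proof (induction v arbitrary: w)
  case (Cons x v)
  then show ?case using word_len_sec_shrinks[of w x] Cons[of "word_sec tr out w x"]
    by (metis diff_le_self le_trans path_sec_Cons)
qed simp

lemma word_len_path_small:
  assumes "word_len tr out w \<le> 2 ^ t" "length v = 2 * N * t"
  shows "word_len tr out (path_sec tr out w v) < N"
  using assms
proof (induction t arbitrary: w v)
  case 0
  then show ?case using N by simp
next
  case (Suc t)
  define v1 where "v1 = take (2 * N) v"
  define v2 where "v2 = drop (2 * N) v"
  have v: "v = v1 @ v2" "length v1 = 2 * N" "length v2 = 2 * N * t"
    using Suc.prems by (auto simp: v1_def v2_def)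
  from word_len_path_halves[OF Suc.prems(1) v(2)] show ?case
  proof
    assume "word_len tr out (path_sec tr out w v1) \<le> 2 ^ t"
    from Suc.IH[OF this v(3)] show ?thesis by (simp add: v(1) path_sec_append)
  next
    assume "word_len tr out (path_sec tr out w v1) < N"
    then show ?thesis
      using word_len_path_antimono[of "path_sec tr out w v1" v2] by (simp add: v(1) path_sec_append)
  qed
qed

text \<open>Finitely many words represent all elements of length below N. Each nontrivial one moves
  some path, and \<open>K\<close> is the largest length among the chosen paths.\<close>

lemma short_words_depth:
  "\<exists>K. \<forall>w. word_len tr out w < N \<longrightarrow> (\<forall>v. length v = K \<longrightarrow> word_act tr out w v = v) \<longrightarrow>
     word_act tr out w = id"
proof -
  define F where "F = {u :: 's list. set u \<subseteq> UNIV \<and> length u \<le> N}"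
  have finF: "finite F" unfolding F_def by (intro finite_lists_length_le) auto
  have "\<forall>u. \<exists>v. word_act tr out u \<noteq> id \<longrightarrow> word_act tr out u v \<noteq> v" by (metis ext id_apply)
  then obtain f where f: "\<And>u. word_act tr out u \<noteq> id \<Longrightarrow> word_act tr out u (f u) \<noteq> f u" by metis
  define K where "K = Max ((\<lambda>u. length (f u)) ` F)"
  have K: "length (f u) \<le> K" if "u \<in> F" for u
    unfolding K_def using finF that by (intro Max_ge) auto
  show ?thesis
  proof (intro exI[of _ K] allI impI)
    fix w assume w: "word_len tr out w < N" "\<forall>v. length v = K \<longrightarrow> word_act tr out w v = v"
    obtain u where u: "length u = word_len tr out w" "word_act tr out u = word_act tr out w"
      by (rule word_len_witness)
    have "u \<in> F" using u w by (auto simp: F_def)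
    then have "word_act tr out w (f u) = f u" using K w(2) by (intro word_act_extend_prefix) auto
    then show "word_act tr out w = id" using f[of u] u by auto
  qed
qed

lemma contracting_depth_aux:
  "\<exists>C. \<forall>w t. length w \<le> 2 ^ t \<longrightarrow>
     (\<forall>v. length v = C * Suc t \<longrightarrow> word_act tr out w v = v) \<longrightarrow> word_act tr out w = id"
proof -
  obtain K where K: "\<And>w. word_len tr out w < N \<Longrightarrow>
      (\<And>v. length v = K \<Longrightarrow> word_act tr out w v = v) \<Longrightarrow> word_act tr out w = id"
    using short_words_depth by blast
  have "word_act tr out w = id" if w: "length w \<le> 2 ^ t"
    and triv: "\<forall>v. length v = (2 * N + K) * Suc t \<longrightarrow> word_act tr out w v = v" for w t
  proof
    fix v
    \<comment> \<open>The first j letters shorten the word below N, and K further letters test the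
      short section.\<close>
    define j where "j = 2 * N * t"
    have "j + K \<le> (2 * N + K) * Suc t" by (simp add: j_def algebra_simps)
    then have triv': "word_act tr out w v = v" if "length v \<le> j + K" for v
      using that by (intro word_act_extend_prefix[OF triv]) auto
    show "word_act tr out w v = id v"
    proof (cases "length v \<le> j")
      case True
      then show ?thesis using triv' by simp
    next
      case False
      define v1 where "v1 = take j v"
      define v2 where "v2 = drop j v"
      have v: "v = v1 @ v2" "length v1 = j" using False by (auto simp: v1_def v2_def)
      have "word_len tr out w \<le> 2 ^ t" using word_len_le[of tr out w w] w by simp
      then have "word_len tr out (path_sec tr out w v1) < N"
        using v(2) by (intro word_len_path_small) (auto simp: j_def)
      moreover have "word_act tr out (path_sec tr out w v1) v' = v'" if "length v' = K" for v'
        using triv'[of "v1 @ v'"] v that by (simp add: word_act_append_path)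
      ultimately have "word_act tr out (path_sec tr out w v1) = id" by (rule K)
      then show ?thesis using triv'[of v1] v by (simp add: word_act_append_path)
    qed
  qed
  then show ?thesis by (intro exI[of _ "2 * N + K"]) blast
qed

end

theorem contracting_depth:
  fixes tr :: "'s::finite \<Rightarrow> 'x \<Rightarrow> 's"
  assumes "contracting_aut tr out"
  shows "\<exists>C. \<forall>w t. length w \<le> 2 ^ t \<longrightarrow>
     (\<forall>v. length v = C * Suc t ^ 1 \<longrightarrow> word_act tr out w v = v) \<longrightarrow> word_act tr out w = id"
proof -
  from assms obtain N where "\<And>w x. N \<le> length w \<Longrightarrow> word_len tr out (word_sec tr out w x) < length w"
    by (auto simp: contracting_aut_def)
  \<comment> \<open>Raising the threshold to at least 2 preserves the contraction hypothesis and
    makes words of length at most 1 count as short.\<close>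
  then show ?thesis using contracting_depth_aux[of "max 2 N" tr out] by simp
qed

section \<open>Stack programs and their compilation to Turing machines\<close>

text \<open>A stack is kept on a tape with its top under the head and the rest to the right, so the
  input tape is already a stack holding the input word. The finite store of type 'q becomes part of
  the control state.\<close>

datatype ('q, 'g) com =
    Push nat "'q \<Rightarrow> 'g"
  | Pop nat "'q \<Rightarrow> 'g option \<Rightarrow> 'q"
  | Upd "'q \<Rightarrow> 'q"
  | Seq "('q, 'g) com" "('q, 'g) com"
  | Cond "'q \<Rightarrow> bool" "('q, 'g) com" "('q, 'g) com"
  | While "'q \<Rightarrow> bool" "('q, 'g) com"

text \<open>The number is the exact step count of the compiled machine; a push moves the head left and
  writes afterwards, hence costs two steps.\<close>

inductive exec :: "('q, 'g) com \<Rightarrow> 'q \<times> (nat \<Rightarrow> 'g list) \<Rightarrow> nat \<Rightarrow> 'q \<times> (nat \<Rightarrow> 'g list) \<Rightarrow> bool" where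
  Push: "exec (Push i f) (q, S) 2 (q, S(i := f q # S i))"
| Pop: "exec (Pop i f) (q, S) 1 (f q (case S i of [] \<Rightarrow> None | a # _ \<Rightarrow> Some a), S(i := tl (S i)))"
| Upd: "exec (Upd f) (q, S) 1 (f q, S)"
| Seq: "exec a s m s' \<Longrightarrow> exec b s' n s'' \<Longrightarrow> exec (Seq a b) s (Suc (m + n)) s''"
| CondT: "b q \<Longrightarrow> exec a (q, S) n s' \<Longrightarrow> exec (Cond b a c) (q, S) (Suc n) s'"
| CondF: "\<not> b q \<Longrightarrow> exec c (q, S) n s' \<Longrightarrow> exec (Cond b a c) (q, S) (Suc n) s'"
| WhileF: "\<not> b q \<Longrightarrow> exec (While b c) (q, S) 1 (q, S)"
| WhileT: "b q \<Longrightarrow> exec c (q, S) m s' \<Longrightarrow> exec (While b c) s' n s'' \<Longrightarrow>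
    exec (While b c) (q, S) (Suc (m + n)) s''"

fun stacks_below :: "nat \<Rightarrow> ('q, 'g) com \<Rightarrow> bool" where
  "stacks_below K (Push i f) \<longleftrightarrow> i < K"
| "stacks_below K (Pop i f) \<longleftrightarrow> i < K"
| "stacks_below K (Upd f) \<longleftrightarrow> True"
| "stacks_below K (Seq a b) \<longleftrightarrow> stacks_below K a \<and> stacks_below K b"
| "stacks_below K (Cond b a c) \<longleftrightarrow> stacks_below K a \<and> stacks_below K c"
| "stacks_below K (While b c) \<longleftrightarrow> stacks_below K c"

text \<open>These are the lists of commands that can be pending while c runs, up to the moment when
  only k is left. A loop body has the loop itself as continuation, so the set stays finite and can
  serve as machine control.\<close>

fun conts :: "('q, 'g) com \<Rightarrow> ('q, 'g) com list \<Rightarrow> ('q, 'g) com list set" where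
  "conts (Seq a b) k = insert (Seq a b # k) (conts a (b # k) \<union> conts b k)"
| "conts (Cond b a c) k = insert (Cond b a c # k) (conts a k \<union> conts c k)"
| "conts (While b c) k = insert (While b c # k) (conts c (While b c # k))"
| "conts c k = {c # k}"

fun succs :: "('q, 'g) com list \<Rightarrow> ('q, 'g) com list set" where
  "succs [] = {}"
| "succs (Seq a b # k) = {a # b # k}"
| "succs (Cond b a c # k) = {a # k, c # k}"
| "succs (While b c # k) = {c # While b c # k, k}"
| "succs (c # k) = {k}"

lemma conts_self: "c # k \<in> conts c k"
  by (cases c) auto

lemma finite_conts: "finite (conts c k)"
  by (induction c k rule: conts.induct) auto

lemma conts_succs: "l \<in> conts c k \<Longrightarrow> l' \<in> succs l \<Longrightarrow> l' \<in> conts c k \<or> l' = k"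
proof (induction c k arbitrary: l l' rule: conts.induct)
  case (1 a b k)
  from "1.prems"(1) consider "l = Seq a b # k" | "l \<in> conts a (b # k)" | "l \<in> conts b k" by auto
  then show ?case
  proof cases
    case 1
    then show ?thesis using "1.prems"(2) conts_self[of a "b # k"] by auto
  next
    case 2
    then show ?thesis using "1.IH"(1)[OF 2 "1.prems"(2)] conts_self[of b k] by auto
  next
    case 3
    then show ?thesis using "1.IH"(2)[OF 3 "1.prems"(2)] by auto
  qed
next
  case (2 b a c k)
  from "2.prems"(1) consider "l = Cond b a c # k" | "l \<in> conts a k" | "l \<in> conts c k" by auto
  then show ?case
  proof cases
    case 1
    then show ?thesis using "2.prems"(2) conts_self[of a k] conts_self[of c k] by auto
  next
    case 2
    then show ?thesis using "2.IH"(1)[OF 2 "2.prems"(2)] by auto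
  next
    case 3
    then show ?thesis using "2.IH"(2)[OF 3 "2.prems"(2)] by auto
  qed
next
  case (3 b c k)
  from "3.prems"(1) consider "l = While b c # k" | "l \<in> conts c (While b c # k)" by auto
  then show ?case
  proof cases
    case 1
    then show ?thesis using "3.prems"(2) conts_self[of c "While b c # k"] by auto
  next
    case 2
    then show ?thesis using "3.IH"[OF 2 "3.prems"(2)] by auto
  qed
qed auto

lemma conts_tl: "l \<in> conts c k \<Longrightarrow> tl l \<in> conts c k \<or> tl l = k"
proof (induction c k arbitrary: l rule: conts.induct)
  case (1 a b k)
  then show ?case using conts_self[of b k] by (metis UnE UnI1 UnI2 conts.simps(1) insertE insertCI list.sel(3))
qed auto

lemma conts_stacks_below:
  "stacks_below K c \<Longrightarrow> (\<And>c'. c' \<in> set k \<Longrightarrow> stacks_below K c') \<Longrightarrow> l \<in> conts c k \<Longrightarrow>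
    c' \<in> set l \<Longrightarrow> stacks_below K c'"
proof (induction c k arbitrary: l c' rule: conts.induct)
  case (1 a b k)
  from "1.prems"(3) consider "l = Seq a b # k" | "l \<in> conts a (b # k)" | "l \<in> conts b k" by auto
  then show ?case
  proof cases
    case 1 then show ?thesis using "1.prems" by auto
  next
    case 2
    show ?thesis by (rule "1.IH"(1)[OF _ _ 2 "1.prems"(4)]) (use "1.prems"(1,2) in auto)
  next
    case 3
    show ?thesis by (rule "1.IH"(2)[OF _ _ 3 "1.prems"(4)]) (use "1.prems"(1,2) in auto)
  qed
next
  case (2 b a c k)
  from "2.prems"(3) consider "l = Cond b a c # k" | "l \<in> conts a k" | "l \<in> conts c k" by auto
  then show ?case
  proof cases
    case 1 then show ?thesis using "2.prems" by auto
  next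
    case 2
    show ?thesis by (rule "2.IH"(1)[OF _ _ 2 "2.prems"(4)]) (use "2.prems"(1,2) in auto)
  next
    case 3
    show ?thesis by (rule "2.IH"(2)[OF _ _ 3 "2.prems"(4)]) (use "2.prems"(1,2) in auto)
  qed
next
  case (3 b c k)
  from "3.prems"(3) consider "l = While b c # k" | "l \<in> conts c (While b c # k)" by auto
  then show ?case
  proof cases
    case 1 then show ?thesis using "3.prems" by auto
  next
    case 2
    show ?thesis by (rule "3.IH"[OF _ _ 2 "3.prems"(4)]) (use "3.prems"(1,2) in auto)
  qed
qed auto

section \<open>The compiled machine\<close>

locale stack_compiler =
  fixes c0 :: "('q::finite, 'g::finite) com" and K :: nat and A :: "'q \<Rightarrow> bool"
    and enc :: "'g \<Rightarrow> nat" and f :: "('q, 'g) com list \<times> 'q \<times> bool \<Rightarrow> nat"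
  assumes K: "1 \<le> K" "stacks_below K c0"
    and enc_inj: "inj enc" and enc_range: "enc a < card (UNIV :: 'g set)"
    and f_inj: "inj_on f (insert [] (conts c0 []) \<times> UNIV)"
    and f_range: "x \<in> insert [] (conts c0 []) \<times> UNIV \<Longrightarrow> f x < card (insert [] (conts c0 []) \<times> (UNIV :: ('q \<times> bool) set))"
begin

text \<open>The truth value records whether a push has already moved its head.\<close>

definition Ctl :: "(('q, 'g) com list \<times> 'q \<times> bool) set" where
  "Ctl = insert [] (conts c0 []) \<times> UNIV"

definition esym :: "'g \<Rightarrow> nat" where "esym a = Suc (enc a)"

definition dsym :: "nat \<Rightarrow> 'g option" where
  "dsym n = (if n = 0 then None else Some (inv enc (n - 1)))"

text \<open>Halting states must be single numbers, so an empty continuation is collapsed to 0 or 1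
  according to the verdict \<open>A\<close> on the store, and all other control states are shifted
  by 2.\<close>

definition code :: "('q, 'g) com list \<times> 'q \<times> bool \<Rightarrow> nat" where
  "code x = (if fst x = [] then (if A (fst (snd x)) then 0 else 1) else 2 + f x)"

definition decode :: "nat \<Rightarrow> ('q, 'g) com list \<times> 'q \<times> bool" where
  "decode n = inv_into Ctl f (n - 2)"

abbreviation still :: "int list" where "still \<equiv> replicate K 0"

text \<open>A machine step writes before it moves, which forces the two phases of a push. A pop
  moves right without erasing, and stays put on a blank so that an empty stack remains in
  place.\<close>

fun cstep :: "('q, 'g) com list \<Rightarrow> 'q \<Rightarrow> bool \<Rightarrow> nat list \<Rightarrow>
    (('q, 'g) com list \<times> 'q \<times> bool) \<times> nat list \<times> int list" where
  "cstep (Push i g # k) q ph r = (if ph then ((k, q, False), r[i := esym (g q)], still)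
     else ((Push i g # k, q, True), r, still[i := -1]))"
| "cstep (Pop i g # k) q ph r =
     ((k, g q (dsym (r ! i)), False), r, still[i := if r ! i = 0 then 0 else 1])"
| "cstep (Upd g # k) q ph r = ((k, g q, False), r, still)"
| "cstep (Seq a b # k) q ph r = ((a # b # k, q, False), r, still)"
| "cstep (Cond b a c # k) q ph r = (((if b q then a else c) # k, q, False), r, still)"
| "cstep (While b c # k) q ph r = ((if b q then c # While b c # k else k, q, False), r, still)"
| "cstep [] q ph r = (([], q, ph), r, still)"

definition delta :: "nat \<Rightarrow> nat list \<Rightarrow> nat \<times> nat list \<times> int list" where
  "delta n r = (if n < 2 then (n, r, still)
     else case decode n of (l, q, ph) \<Rightarrow> case cstep l q ph r of (x, ws, mv) \<Rightarrow> (code x, ws, mv))"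

definition machine :: "'q \<Rightarrow> tm" where
  "machine q0 = \<lparr>tm_tapes = K, tm_nstates = 2 + card Ctl, tm_nsyms = Suc (card (UNIV :: 'g set)),
     tm_delta = delta, tm_start = code ([c0], q0, False), tm_acc = 0, tm_rej = 1\<rparr>"

lemma machine_simps [simp]:
  "tm_tapes (machine q0) = K" "tm_nstates (machine q0) = 2 + card Ctl"
  "tm_nsyms (machine q0) = Suc (card (UNIV :: 'g set))" "tm_delta (machine q0) = delta"
  "tm_start (machine q0) = code ([c0], q0, False)" "tm_acc (machine q0) = 0" "tm_rej (machine q0) = 1"
  by (simp_all add: machine_def)

lemma finite_Ctl: "finite Ctl"
  by (simp add: Ctl_def finite_conts)

lemma code_less: "x \<in> Ctl \<Longrightarrow> code x < 2 + card Ctl"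
  using f_range[of x] by (auto simp: code_def Ctl_def)

lemma decode_code: "x \<in> Ctl \<Longrightarrow> fst x \<noteq> [] \<Longrightarrow> decode (code x) = x"
  using f_inj by (simp add: decode_def code_def Ctl_def)

text \<open>\<open>tm_wf\<close> constrains the transition function at all state numbers, also
  unreachable ones, so every number must decode to a control state. Counting shows that f is onto;
  for n < 2 the truncated difference is 0, which is in range too.\<close>

lemma decode_Ctl:
  assumes "n < 2 + card Ctl" shows "decode n \<in> Ctl"
proof -
  have "f ` Ctl \<subseteq> {..<card Ctl}" using f_range by (auto simp: Ctl_def)
  moreover have "card (f ` Ctl) = card Ctl" using f_inj by (intro card_image) (simp add: Ctl_def)
  ultimately have eq: "f ` Ctl = {..<card Ctl}" by (intro card_subset_eq) auto
  have "card Ctl > 0" using finite_Ctl by (auto simp: card_gt_0_iff Ctl_def)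
  then have "n - 2 \<in> f ` Ctl" using assms eq by auto
  then show ?thesis unfolding decode_def by (rule inv_into_into)
qed

lemma cstep_valid:
  assumes "(l, q, ph) \<in> Ctl" "length r = K" "set r \<subseteq> {..<Suc (card (UNIV :: 'g set))}"
    and "cstep l q ph r = (x, ws, mv)"
  shows "x \<in> Ctl \<and> length ws = K \<and> set ws \<subseteq> {..<Suc (card (UNIV :: 'g set))} \<and>
    length mv = K \<and> set mv \<subseteq> {-1, 0, 1}"
proof -
  have mv: "a = -1 \<or> a = 0 \<or> a = 1" if "a \<in> set (still[i := j])" "j = -1 \<or> j = 0 \<or> j = 1" for i j a
    using set_update_subset_insert[of still i j] that by auto
  have ws: "set (r[i := esym a]) \<subseteq> {..<Suc (card (UNIV :: 'g set))}" for i a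
    using set_update_subset_insert[of r i "esym a"] assms(3) enc_range[of a] by (auto simp: esym_def)
  have l: "l = [] \<or> l \<in> conts c0 []" using assms(1) by (auto simp: Ctl_def)
  then have "fst x \<in> insert l (succs l)"
    using assms(4) by (cases "(l, q, ph, r)" rule: cstep.cases) (auto split: if_splits)
  with l have "fst x \<in> insert [] (conts c0 [])" using conts_succs[of l c0 "[]" "fst x"] by auto
  then have "x \<in> Ctl" by (cases x) (auto simp: Ctl_def)
  moreover have "length ws = K \<and> set ws \<subseteq> {..<Suc (card (UNIV :: 'g set))}"
    using assms(2-4) ws by (cases "(l, q, ph, r)" rule: cstep.cases) (auto split: if_splits)
  moreover have "length mv = K \<and> set mv \<subseteq> {-1, 0, 1}"
    using assms(4) by (cases "(l, q, ph, r)" rule: cstep.cases) (auto split: if_splits dest: mv)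
  ultimately show ?thesis by blast
qed

lemma machine_wf: "tm_wf (machine q0)"
proof -
  have "case delta n r of (q', ws, mv) \<Rightarrow> q' < 2 + card Ctl \<and> length ws = K \<and>
      set ws \<subseteq> {..<Suc (card (UNIV :: 'g set))} \<and> length mv = K \<and> set mv \<subseteq> {-1, 0, 1}"
    if "n < 2 + card Ctl" "length r = K" "set r \<subseteq> {..<Suc (card (UNIV :: 'g set))}" for n r
  proof (cases "n < 2")
    case True
    then show ?thesis using that by (auto simp: delta_def)
  next
    case False
    obtain l q ph where d: "decode n = (l, q, ph)" by (cases "decode n")
    obtain x ws mv where c: "cstep l q ph r = (x, ws, mv)" by (cases "cstep l q ph r")
    have "(l, q, ph) \<in> Ctl" using decode_Ctl[OF that(1)] d by simp
    from cstep_valid[OF this that(2,3) c] show ?thesis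
      using code_less[of x] False c d by (simp add: delta_def)
  qed
  moreover have "([c0], q0, False) \<in> Ctl" using conts_self[of c0 "[]"] by (auto simp: Ctl_def)
  ultimately show ?thesis using K code_less by (auto simp: tm_wf_def)
qed

text \<open>Cells to the left of the head are left unspecified, because pops leave old symbols
  there.\<close>

definition holds_stack :: "(int \<Rightarrow> nat) \<Rightarrow> int \<Rightarrow> 'g list \<Rightarrow> bool" where
  "holds_stack tp h l \<longleftrightarrow> (\<forall>i. tp (h + int i) = (if i < length l then esym (l ! i) else 0))"

definition rep :: "('q, 'g) com list \<Rightarrow> 'q \<times> (nat \<Rightarrow> 'g list) \<Rightarrow> tm_config \<Rightarrow> bool" where
  "rep l s cfg \<longleftrightarrow> (\<exists>tp hs. cfg = (code (l, fst s, False), tp, hs) \<and> length tp = K \<and> length hs = K \<and>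
     (\<forall>i<K. holds_stack (tp ! i) (hs ! i) (snd s i)))"

lemma holds_stack_top: "holds_stack tp h l \<Longrightarrow> dsym (tp h) = (case l of [] \<Rightarrow> None | a # _ \<Rightarrow> Some a)"
  and holds_stack_empty: "holds_stack tp h l \<Longrightarrow> tp h = 0 \<longleftrightarrow> l = []"
  using enc_inj
  by (auto simp: holds_stack_def dsym_def esym_def dest!: spec[of _ 0] split: list.split if_splits)

lemma holds_stack_tl: "holds_stack tp h (a # l) \<Longrightarrow> holds_stack tp (h + 1) l"
  unfolding holds_stack_def
proof
  fix i assume "\<forall>i. tp (h + int i) = (if i < length (a # l) then esym ((a # l) ! i) else 0)"
  from this[THEN spec, of "Suc i"] show "tp (h + 1 + int i) = (if i < length l then esym (l ! i) else 0)"
    by (simp add: ac_simps)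
qed

lemma holds_stack_Cons: "holds_stack tp h l \<Longrightarrow> holds_stack (tp(h - 1 := esym a)) (h - 1) (a # l)"
  unfolding holds_stack_def
proof
  fix i assume *: "\<forall>i. tp (h + int i) = (if i < length l then esym (l ! i) else 0)"
  show "(tp(h - 1 := esym a)) (h - 1 + int i) = (if i < length (a # l) then esym ((a # l) ! i) else 0)"
    using *[THEN spec, of "i - 1"] by (cases i) (auto simp: algebra_simps)
qed

lemma step_cstep:
  assumes "l \<in> conts c0 []" "l \<noteq> []"
    and "cstep l q ph (map (\<lambda>i. (tp ! i) (hs ! i)) [0..<K]) = (x, ws, mv)"
  shows "tm_step (machine q0) (code (l, q, ph), tp, hs) =
    (code x, map (\<lambda>i. (tp ! i)(hs ! i := ws ! i)) [0..<K], map (\<lambda>i. hs ! i + mv ! i) [0..<K])"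
proof -
  have "(l, q, ph) \<in> Ctl" using assms by (auto simp: Ctl_def)
  then have d: "decode (code (l, q, ph)) = (l, q, ph)" using assms decode_code by auto
  have "\<not> code (l, q, ph) < 2" using assms by (simp add: code_def)
  then show ?thesis using assms(3) d by (simp add: tm_step_def delta_def)
qed

lemma rep_step_still:
  assumes "l \<in> conts c0 []" "l \<noteq> []" "rep l (q, S) cfg"
    and "\<And>r. cstep l q False r = ((l', q', False), r, still)"
  shows "rep l' (q', S) (tm_step (machine q0) cfg)"
proof -
  from assms(3) obtain tp hs where cfg: "cfg = (code (l, q, False), tp, hs)" "length tp = K" "length hs = K"
    "\<forall>i<K. holds_stack (tp ! i) (hs ! i) (S i)" by (auto simp: rep_def)
  have "map (\<lambda>i. (tp ! i)(hs ! i := (map (\<lambda>i. (tp ! i) (hs ! i)) [0..<K]) ! i)) [0..<K] = tp"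
    using cfg by (intro nth_equalityI) auto
  moreover have "map (\<lambda>i. hs ! i + still ! i) [0..<K] = hs"
    using cfg by (intro nth_equalityI) auto
  ultimately show ?thesis
    using cfg step_cstep[OF assms(1,2) assms(4)] by (auto simp: rep_def)
qed

lemma rep_pop:
  assumes l: "Pop i g # k \<in> conts c0 []" and rep: "rep (Pop i g # k) (q, S) cfg" and i: "i < K"
  shows "rep k (g q (case S i of [] \<Rightarrow> None | a # _ \<Rightarrow> Some a), S(i := tl (S i))) (tm_step (machine q0) cfg)"
proof -
  from rep obtain tp hs where cfg: "cfg = (code (Pop i g # k, q, False), tp, hs)" "length tp = K" "length hs = K"
    "\<forall>i<K. holds_stack (tp ! i) (hs ! i) (S i)" by (auto simp: rep_def)
  define r where "r = map (\<lambda>i. (tp ! i) (hs ! i)) [0..<K]"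
  have ri: "r ! i = (tp ! i) (hs ! i)" using i by (simp add: r_def)
  have tp: "map (\<lambda>j. (tp ! j)(hs ! j := r ! j)) [0..<K] = tp"
    using cfg by (intro nth_equalityI) (auto simp: r_def)
  have 1: "dsym (r ! i) = (case S i of [] \<Rightarrow> None | a # _ \<Rightarrow> Some a)" "r ! i = 0 \<longleftrightarrow> S i = []"
    unfolding ri using cfg(4) i holds_stack_top holds_stack_empty by blast+
  have hs: "holds_stack (tp ! j) (hs ! j + (still[i := if r ! i = 0 then 0 else 1]) ! j) ((S(i := tl (S i))) j)"
    if "j < K" for j
  proof (cases "j = i")
    case True
    then show ?thesis using cfg(4) i 1(2) by (cases "S i") (auto intro!: holds_stack_tl)
  next
    case False
    then show ?thesis using that cfg(4) by simp
  qed
  show ?thesis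
    using step_cstep[OF l, of q False tp hs _ _ _ q0] 1(1) hs tp cfg(1,2)
    unfolding r_def[symmetric] by (auto simp: rep_def)
qed

lemma rep_push:
  assumes l: "Push i g # k \<in> conts c0 []" and rep: "rep (Push i g # k) (q, S) cfg" and i: "i < K"
  shows "rep k (q, S(i := g q # S i)) (tm_step (machine q0) (tm_step (machine q0) cfg))"
proof -
  from rep obtain tp hs where cfg: "cfg = (code (Push i g # k, q, False), tp, hs)" "length tp = K" "length hs = K"
    "\<forall>i<K. holds_stack (tp ! i) (hs ! i) (S i)" by (auto simp: rep_def)
  define r where "r = map (\<lambda>i. (tp ! i) (hs ! i)) [0..<K]"
  have tp: "map (\<lambda>j. (tp ! j)(hs ! j := r ! j)) [0..<K] = tp"
    using cfg by (intro nth_equalityI) (auto simp: r_def)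
  define hs' where "hs' = map (\<lambda>j. hs ! j + (still[i := -1]) ! j) [0..<K]"
  have 1: "tm_step (machine q0) cfg = (code (Push i g # k, q, True), tp, hs')"
    using step_cstep[OF l, of q False tp hs _ _ _ q0] cfg(1) tp
    unfolding r_def[symmetric] by (simp add: hs'_def)
  define r' where "r' = (map (\<lambda>i. (tp ! i) (hs' ! i)) [0..<K])[i := esym (g q)]"
  define tp' where "tp' = map (\<lambda>j. (tp ! j)(hs' ! j := r' ! j)) [0..<K]"
  have hs': "map (\<lambda>j. hs' ! j + still ! j) [0..<K] = hs'"
    by (intro nth_equalityI) (auto simp: hs'_def)
  have 2: "tm_step (machine q0) (code (Push i g # k, q, True), tp, hs') = (code (k, q, False), tp', hs')"
    using step_cstep[OF l, of q True tp hs' _ _ _ q0] hs'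
    by (simp add: r'_def tp'_def)
  have "holds_stack (tp' ! j) (hs' ! j) ((S(i := g q # S i)) j)" if j: "j < K" for j
  proof (cases "j = i")
    case True
    then show ?thesis using cfg(4) j by (auto simp: tp'_def hs'_def r'_def holds_stack_Cons)
  next
    case False
    then show ?thesis using cfg(4) j by (auto simp: tp'_def hs'_def r'_def)
  qed
  then show ?thesis unfolding 1 2 by (auto simp: rep_def tp'_def hs'_def)
qed

lemma funpow_Suc_add: "(F ^^ Suc (m + n)) x = (F ^^ n) ((F ^^ m) (F x))"
  by (simp add: funpow_swap1 add.commute[of m] funpow_add)

text \<open>The continuation k is arbitrary in the induction: parts of a sequence and bodies of
  loops run with what follows them as a longer continuation.\<close>

lemma simulation:
  "exec c s n s' \<Longrightarrow> c # k \<in> conts c0 [] \<Longrightarrow> rep (c # k) s cfg \<Longrightarrow>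
    rep k s' ((tm_step (machine q0) ^^ n) cfg)"
proof (induction arbitrary: k cfg rule: exec.induct)
  case (Push i f q S)
  have "stacks_below K (Push i f)"
    by (rule conts_stacks_below[OF K(2) _ Push(1)]) auto
  then have "rep k (q, S(i := f q # S i)) (tm_step (machine q0) (tm_step (machine q0) cfg))"
    using Push by (intro rep_push) auto
  then show ?case by (simp add: numeral_2_eq_2)
next
  case (Pop i f q S)
  have "stacks_below K (Pop i f)"
    by (rule conts_stacks_below[OF K(2) _ Pop(1)]) auto
  then show ?case using rep_pop[OF Pop] by simp
next
  case (Upd f q S)
  show ?case using rep_step_still[OF Upd(1) _ Upd(2)] by simp
next
  case (Seq a s m s' b n s'')
  obtain q S where s: "s = (q, S)" by (cases s)
  have c: "a # b # k \<in> conts c0 []" "b # k \<in> conts c0 []"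
    using conts_succs[OF Seq.prems(1), of "a # b # k"] conts_tl[of "a # b # k" c0 "[]"] by auto
  have "rep (a # b # k) s (tm_step (machine q0) cfg)"
    using rep_step_still[OF Seq.prems(1) _ Seq.prems(2)[unfolded s]] by (simp add: s)
  from Seq.IH(2)[OF c(2) Seq.IH(1)[OF c(1) this]] show ?case
    by (simp only: funpow_Suc_add)
next
  case (CondT b q a S n s' c)
  have c: "a # k \<in> conts c0 []" using conts_succs[OF CondT.prems(1), of "a # k"] by auto
  have "rep (a # k) (q, S) (tm_step (machine q0) cfg)"
    using rep_step_still[OF CondT.prems(1) _ CondT.prems(2)] CondT.hyps by simp
  from CondT.IH[OF c this] show ?case by (simp add: funpow_swap1)
next
  case (CondF b q c S n s' a)
  have c: "c # k \<in> conts c0 []" using conts_succs[OF CondF.prems(1), of "c # k"] by auto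
  have "rep (c # k) (q, S) (tm_step (machine q0) cfg)"
    using rep_step_still[OF CondF.prems(1) _ CondF.prems(2)] CondF.hyps by simp
  from CondF.IH[OF c this] show ?case by (simp add: funpow_swap1)
next
  case (WhileF b q c S)
  show ?case using rep_step_still[OF WhileF.prems(1) _ WhileF.prems(2)] WhileF.hyps by simp
next
  case (WhileT b q c S m s' n s'')
  have c: "c # While b c # k \<in> conts c0 []"
    using conts_succs[OF WhileT.prems(1), of "c # While b c # k"] by auto
  have "rep (c # While b c # k) (q, S) (tm_step (machine q0) cfg)"
    using rep_step_still[OF WhileT.prems(1) _ WhileT.prems(2)] WhileT.hyps by simp
  from WhileT.IH(2)[OF WhileT.prems(1) WhileT.IH(1)[OF c this]] show ?case
    by (simp only: funpow_Suc_add)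
qed

lemma machine_run:
  assumes "exec c0 (q0, (\<lambda>_. [])(0 := map h w)) n (q', S')"
  shows "fst (tm_run (machine q0) (\<lambda>a. esym (h a)) w n) = (if A q' then 0 else 1)"
proof -
  have "rep [c0] (q0, (\<lambda>_. [])(0 := map h w)) (tm_init (machine q0) (\<lambda>a. esym (h a)) w)"
    unfolding rep_def
  proof (intro exI conjI)
    show "tm_init (machine q0) (\<lambda>a. esym (h a)) w = (code ([c0], fst (q0, (\<lambda>_. [])(0 := map h w)), False),
      (\<lambda>i. if 0 \<le> i \<and> i < int (length w) then esym (h (w ! nat i)) else 0) # replicate (K - 1) (\<lambda>_. 0),
      replicate K 0)" by (simp add: tm_init_def)
    show "\<forall>i<K. holds_stack (((\<lambda>i. if 0 \<le> i \<and> i < int (length w) then esym (h (w ! nat i)) else 0) #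
        replicate (K - 1) (\<lambda>_. 0)) ! i) (replicate K 0 ! i) (snd (q0, (\<lambda>_. [])(0 := map h w)) i)"
      by (auto simp: holds_stack_def nth_Cons')
  qed (use K in auto)
  from simulation[OF assms conts_self this, of q0] show ?thesis by (auto simp: rep_def code_def tm_run_def)
qed

end

theorem DTIME_star_stack_program:
  fixes c :: "('q::finite, 'g::finite) com" and h :: "'a::finite \<Rightarrow> 'g" and C :: real
  assumes "1 \<le> K" "stacks_below K c" "inj h"
    and run: "\<And>w. \<exists>n q S. exec c (q0, (\<lambda>_. [])(0 := map h w)) n (q, S) \<and> (A q \<longleftrightarrow> w \<in> L) \<and>
      (N \<le> length w \<longrightarrow> real n \<le> C * T (length w))"
  shows "L \<in> DTIME_star T"
proof -
  obtain enc :: "'g \<Rightarrow> nat" where "bij_betw enc UNIV {0..<card (UNIV :: 'g set)}"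
    using ex_bij_betw_finite_nat[of "UNIV :: 'g set"] by auto
  then have enc: "inj enc" "\<And>a. enc a < card (UNIV :: 'g set)" by (auto simp: bij_betw_def)
  let ?X = "insert [] (conts c []) \<times> (UNIV :: ('q \<times> bool) set)"
  have "finite ?X" by (simp add: finite_conts)
  then obtain f where "bij_betw f ?X {0..<card ?X}" using ex_bij_betw_finite_nat by blast
  then have f: "inj_on f ?X" "\<And>x. x \<in> ?X \<Longrightarrow> f x < card ?X" by (auto simp: bij_betw_def)
  interpret stack_compiler c K A enc f
    by unfold_locales (use assms(1,2) enc f in auto)
  let ?M = "machine q0" let ?e = "\<lambda>a. esym (h a)"
  have "enc_wf ?M ?e"
    using enc assms(3) by (auto simp: enc_wf_def esym_def inj_def)
  moreover from run obtain n q S where r: "\<And>w. exec c (q0, (\<lambda>_. [])(0 := map h w)) (n w) (q w, S w)"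
    "\<And>w. A (q w) \<longleftrightarrow> w \<in> L" "\<And>w. N \<le> length w \<Longrightarrow> real (n w) \<le> C * T (length w)"
    by metis
  have halt: "fst (tm_run ?M ?e w (n w)) = (if w \<in> L then 0 else 1)" for w
    using machine_run[OF r(1)] r(2) by simp
  have "tm_decides ?M ?e L"
    unfolding tm_decides_def machine_simps using halt by blast
  moreover have "\<forall>w. N \<le> length w \<longrightarrow> tm_halts_within ?M ?e w (C * T (length w))"
    unfolding tm_halts_within_def machine_simps using halt r(3) by (metis insertCI)
  ultimately show ?thesis using machine_wf unfolding DTIME_star_def by blast
qed

section \<open>Running stack programs\<close>

definition runs :: "('q, 'g) com \<Rightarrow> 'q \<times> (nat \<Rightarrow> 'g list) \<Rightarrow> nat \<Rightarrow> 'q \<times> (nat \<Rightarrow> 'g list) \<Rightarrow> bool" where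
  "runs c s T s' \<longleftrightarrow> (\<exists>n\<le>T. exec c s n s')"

lemma runs_exec: "exec c s n s' \<Longrightarrow> runs c s n s'"
  unfolding runs_def by blast

lemmas runs_Push = exec.Push[THEN runs_exec]
  and runs_Upd = exec.Upd[THEN runs_exec]

lemma runs_Seq: "runs a s m s' \<Longrightarrow> runs b s' n s'' \<Longrightarrow> runs (Seq a b) s (Suc (m + n)) s''"
  unfolding runs_def by (meson Suc_le_mono add_mono exec.Seq)

lemma runs_mono: "runs c s m s' \<Longrightarrow> m \<le> n \<Longrightarrow> runs c s n s'"
  unfolding runs_def by (meson le_trans)

text \<open>Popping is the only way to see whether a stack is empty, so the loop tests the symbol
  popped last. The body may overwrite that register, since the next pop reloads it; nested loops
  therefore share it.\<close>

definition foreach :: "nat \<Rightarrow> ('g option \<times> 'v, 'g) com \<Rightarrow> ('g option \<times> 'v, 'g) com" where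
  "foreach i c = Seq (Pop i (\<lambda>(_, v) a. (a, v)))
     (While (\<lambda>(a, v). a \<noteq> None) (Seq c (Pop i (\<lambda>(_, v) a. (a, v)))))"

inductive_cases exec_SeqE: "exec (Seq a b) s n s'"
inductive_cases exec_PopE: "exec (Pop i f) s n s'"

lemma runs_foreach_Nil: "S i = [] \<Longrightarrow> runs (foreach i c) ((a, v), S) 3 ((None, v), S)"
proof -
  assume "S i = []"
  then have "exec (Pop i (\<lambda>(_, v) a. (a, v))) ((a, v), S) 1 ((None, v), S)"
    using exec.Pop[of i "\<lambda>(_, v) a. (a, v)" "(a, v)" S] by (simp add: fun_upd_idem)
  moreover have "exec (While (\<lambda>(a, v). a \<noteq> None) (Seq c (Pop i (\<lambda>(_, v) a. (a, v))))) ((None, v), S) 1 ((None, v), S)"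
    by (rule exec.WhileF) simp
  ultimately have "exec (foreach i c) ((a, v), S) (Suc (1 + 1)) ((None, v), S)"
    unfolding foreach_def by (rule exec.Seq)
  then show ?thesis by (intro runs_exec) (simp add: numeral_3_eq_3)
qed

lemma runs_foreach_Cons:
  assumes S: "S i = b # l" and c: "runs c ((Some b, v), S(i := l)) m s" and rest: "runs (foreach i c) s n s'"
  shows "runs (foreach i c) ((a, v), S) (m + n + 3) s'"
proof -
  let ?P = "Pop i (\<lambda>(_, v) a. (a, v))" and ?b = "\<lambda>(a, v). a \<noteq> None"
  obtain a0 v0 S0 where s: "s = ((a0, v0), S0)" by (metis prod.collapse)
  obtain m' where m': "m' \<le> m" "exec c ((Some b, v), S(i := l)) m' s" using c by (auto simp: runs_def)
  obtain n' where n': "n' \<le> n" "exec (foreach i c) s n' s'" using rest by (auto simp: runs_def)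
  \<comment> \<open>The first pop of the remaining loop is the last pop of the current round, so the
    run of the rest is cut open there and reassembled. The additional three steps are two sequencing
    steps and one loop test.\<close>
  from n'(2) obtain k1 k2 s1 where k: "n' = Suc (k1 + k2)" "exec ?P s k1 s1" "exec (While ?b (Seq c ?P)) s1 k2 s'"
    unfolding foreach_def by (elim exec_SeqE) auto
  have k1: "k1 = 1" using k(2) by (elim exec_PopE) auto
  have "exec ?P ((a, v), S) 1 ((Some b, v), S(i := l))"
    using exec.Pop[of i "\<lambda>(_, v) a. (a, v)" "(a, v)" S] S by simp
  moreover have "exec (While ?b (Seq c ?P)) ((Some b, v), S(i := l)) (Suc (Suc (m' + k1) + k2)) s'"
    by (rule exec.WhileT[OF _ exec.Seq[OF m'(2) k(2)] k(3)]) simp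
  ultimately have "exec (foreach i c) ((a, v), S) (Suc (1 + Suc (Suc (m' + k1) + k2))) s'"
    unfolding foreach_def by (rule exec.Seq)
  then show ?thesis unfolding runs_def using m' n' k k1 by (intro exI[of _ "Suc (1 + Suc (Suc (m' + k1) + k2))"]) auto
qed

definition move :: "nat \<Rightarrow> nat \<Rightarrow> ('g option \<times> 'v, 'g) com" where
  "move i j = foreach i (Push j (\<lambda>(a, v). the a))"

lemma runs_move:
  "i \<noteq> j \<Longrightarrow> runs (move i j) ((a, v), S) (5 * length (S i) + 3) ((None, v), S(i := [], j := rev (S i) @ S j))"
proof (induction "S i" arbitrary: S a)
  case Nil
  then have S: "S i = []" by simp
  then have eq: "S(i := [], j := rev (S i) @ S j) = S" by auto
  show ?case unfolding eq using runs_foreach_Nil[of S i, OF S] S by (simp add: move_def)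
next
  case (Cons b l)
  let ?S = "S(i := l, j := b # S j)"
  have "runs (foreach i (Push j (\<lambda>(a, v). the a))) ((Some b, v), ?S) (5 * length l + 3)
    ((None, v), ?S(i := [], j := rev l @ ?S j))"
    using Cons(1)[of ?S "Some b"] Cons(3) by (simp add: move_def)
  moreover have "?S(i := [], j := rev l @ ?S j) = S(i := [], j := rev (S i) @ S j)"
    using Cons(2,3) by (auto simp: fun_eq_iff Cons(2)[symmetric])
  ultimately have 1: "runs (foreach i (Push j (\<lambda>(a, v). the a))) ((Some b, v), ?S) (5 * length l + 3)
    ((None, v), S(i := [], j := rev (S i) @ S j))" by simp
  have 2: "runs (Push j (\<lambda>(a, v). the a)) ((Some b, v), S(i := l)) 2 ((Some b, v), ?S)"
    using runs_Push[of j "\<lambda>(a, v). the a" "(Some b, v)" "S(i := l)"] Cons(3) by simp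
  have "2 + (5 * length l + 3) + 3 = 5 * length (S i) + 3" by (simp add: Cons(2)[symmetric])
  then show ?case
    using runs_foreach_Cons[of S i b l, OF Cons(2)[symmetric] 2 1, of a] by (simp only: move_def)
qed

definition drain :: "nat \<Rightarrow> ('g option \<times> 'v, 'g) com" where
  "drain i = foreach i (Upd id)"

lemma runs_drain: "runs (drain i) ((a, v), S) (4 * length (S i) + 3) ((None, v), S(i := []))"
proof (induction "S i" arbitrary: S a)
  case Nil
  then have "S(i := []) = S" by auto
  with Nil show ?case using runs_foreach_Nil[of S i] by (simp add: drain_def)
next
  case (Cons b l)
  have 1: "runs (foreach i (Upd id)) ((Some b, v), S(i := l)) (4 * length l + 3) ((None, v), S(i := []))"
    using Cons(1)[of "S(i := l)" "Some b"] by (simp add: drain_def)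
  have 2: "runs (Upd id) ((Some b, v), S(i := l)) 1 ((Some b, v), S(i := l))"
    using runs_Upd[of id "(Some b, v)" "S(i := l)"] by simp
  have "1 + (4 * length l + 3) + 3 = 4 * length (S i) + 3" by (simp add: Cons(2)[symmetric])
  then show ?case
    using runs_foreach_Cons[of S i b l, OF Cons(2)[symmetric] 2 1, of a] by (simp only: drain_def)
qed

definition seqs :: "('q, 'g) com list \<Rightarrow> ('q, 'g) com" where
  "seqs cs = foldr Seq cs (Upd id)"

lemma seqs_simps [simp]: "seqs [] = Upd id" "seqs (c # cs) = Seq c (seqs cs)"
  by (simp_all add: seqs_def)

lemma runs_seqs_Nil: "runs (seqs []) s 1 s"
  using runs_Upd[of id "fst s" "snd s"] by simp

lemma runs_seqs_Cons: "runs c s m s' \<Longrightarrow> runs (seqs cs) s' n s'' \<Longrightarrow> runs (seqs (c # cs)) s (Suc (m + n)) s''"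
  using runs_Seq by simp

section \<open>Concrete stacks and evaluation of loop-free programs\<close>

definition stk :: "'g list \<Rightarrow> 'g list \<Rightarrow> 'g list \<Rightarrow> 'g list \<Rightarrow> 'g list \<Rightarrow> 'g list \<Rightarrow> 'g list \<Rightarrow> nat \<Rightarrow> 'g list" where
  "stk a b c d e f g = (\<lambda>_. [])(0 := a, 1 := b, 2 := c, 3 := d, 4 := e, 5 := f, 6 := g)"

lemma stk_apply [simp]:
  "stk a b c d e f g 0 = a" "stk a b c d e f g (Suc 0) = b" "stk a b c d e f g 2 = c"
  "stk a b c d e f g 3 = d" "stk a b c d e f g 4 = e" "stk a b c d e f g 5 = f" "stk a b c d e f g 6 = g"
  by (simp_all add: stk_def)

lemma stk_update [simp]:
  "(stk a b c d e f g)(0 := l) = stk l b c d e f g" "(stk a b c d e f g)(Suc 0 := l) = stk a l c d e f g"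
  "(stk a b c d e f g)(2 := l) = stk a b l d e f g" "(stk a b c d e f g)(3 := l) = stk a b c l e f g"
  "(stk a b c d e f g)(4 := l) = stk a b c d l f g" "(stk a b c d e f g)(5 := l) = stk a b c d e l g"
  "(stk a b c d e f g)(6 := l) = stk a b c d e f l"
  by (auto simp: stk_def fun_eq_iff)

fun loop_free :: "('q, 'g) com \<Rightarrow> bool" where
  "loop_free (Seq a b) \<longleftrightarrow> loop_free a \<and> loop_free b"
| "loop_free (Cond b a c) \<longleftrightarrow> loop_free a \<and> loop_free c"
| "loop_free (While b c) \<longleftrightarrow> False"
| "loop_free _ \<longleftrightarrow> True"

text \<open>Computes result and step count of straight-line code by simplification, so that loop
  bodies need no hand-made derivations. The value at \<open>While\<close> is a placeholder excluded
  by \<open>loop_free\<close>.\<close>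

fun ev :: "('q, 'g) com \<Rightarrow> 'q \<times> (nat \<Rightarrow> 'g list) \<Rightarrow> nat \<times> 'q \<times> (nat \<Rightarrow> 'g list)" where
  "ev (Push i f) (q, S) = (2, q, S(i := f q # S i))"
| "ev (Pop i f) (q, S) = (1, f q (case S i of [] \<Rightarrow> None | a # _ \<Rightarrow> Some a), S(i := tl (S i)))"
| "ev (Upd f) (q, S) = (1, f q, S)"
| "ev (Seq a b) s = (case ev a s of (m, s') \<Rightarrow> case ev b s' of (n, s'') \<Rightarrow> (Suc (m + n), s''))"
| "ev (Cond b a c) (q, S) = (case ev (if b q then a else c) (q, S) of (n, s') \<Rightarrow> (Suc n, s'))"
| "ev (While b c) s = (0, s)"

lemma exec_ev: "loop_free c \<Longrightarrow> exec c s (fst (ev c s)) (snd (ev c s))"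
proof (induction c s rule: ev.induct)
  case (4 a b s)
  then show ?case by (auto split: prod.splits intro: exec.Seq)
next
  case (5 b a c q S)
  then show ?case by (auto split: prod.splits intro: exec.CondT exec.CondF)
qed (auto intro: exec.intros[simplified])

lemma runs_ev: "loop_free c \<Longrightarrow> snd (ev c s) = s' \<Longrightarrow> fst (ev c s) \<le> T \<Longrightarrow> runs c s T s'"
  using exec_ev[of c s] unfolding runs_def by auto

section \<open>The word problem program\<close>

type_synonym ('s, 'x) store = "'s option option \<times> 'x \<times> bool \<times> bool"

text \<open>A level is stored as \<open>enc_blocks bs\<close>, where \<open>None\<close> terminates a block. The store holds the
  symbol popped last, the current letter, whether the section of the current block is nonempty so
  far, and whether all blocks have fixed all letters. Stack 0 is the input, 1 the current level, 2 the
  next level (reversed), 3 scratch space, 4 the level counter and 5, 6 unary numbers.\<close>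

definition enc_blocks :: "'s list list \<Rightarrow> 's option list" where
  "enc_blocks bs = concat (map (\<lambda>b. map Some b @ [None]) bs)"

lemma enc_blocks_simps [simp]:
  "enc_blocks [] = []" "enc_blocks (b # bs) = map Some b @ None # enc_blocks bs"
  "enc_blocks (bs @ cs) = enc_blocks bs @ enc_blocks cs"
  by (simp_all add: enc_blocks_def)

text \<open>Halving the number of input letters; the pop of the surrounding loop makes this
  \<open>u \<mapsto> (u - 1) div 2\<close>.\<close>

fun half_rounds :: "nat \<Rightarrow> nat" where
  "half_rounds 0 = 0"
| "half_rounds (Suc u) = Suc (half_rounds (u div 2))"

lemma half_rounds_upper: "u + 2 \<le> 2 ^ Suc (half_rounds u)"
proof (induction u rule: half_rounds.induct)
  case (2 u)
  have "Suc u + 2 \<le> 2 * (u div 2 + 2)" by presburger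
  also have "\<dots> \<le> 2 * 2 ^ Suc (half_rounds (u div 2))" using 2 by simp
  finally show ?case by simp
qed simp

lemma half_rounds_lower: "2 ^ half_rounds u \<le> u + 1"
proof (induction u rule: half_rounds.induct)
  case (2 u)
  have "2 * 2 ^ half_rounds (u div 2) \<le> 2 * (u div 2 + 1)" using 2 by simp
  also have "\<dots> \<le> Suc u + 1" by presburger
  finally show ?case by simp
qed simp

text \<open>With t = \<open>Suc (half_rounds n)\<close>, \<open>half_rounds_upper\<close> gives n <=
  \<open>2 ^ t\<close>, and \<open>half_rounds n + 2\<close> is \<open>Suc t\<close>. The clock is
  thus the depth \<open>c * Suc t ^ r\<close> demanded by the depth theorems.\<close>

definition clock_value :: "nat \<Rightarrow> nat \<Rightarrow> nat \<Rightarrow> nat" where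
  "clock_value c r n = c * (half_rounds n + 2) ^ r"

locale section_program =
  fixes trn :: "'s::finite \<Rightarrow> 'x::finite \<Rightarrow> 's" and otp :: "'s \<Rightarrow> 'x \<Rightarrow> 'x"
    and B :: "'s set" and xs :: "'x list"
  assumes trivial: "s \<in> B \<Longrightarrow> trn s x = s \<and> otp s x = x"
    and otp_bij: "bij (otp s)"
    and xs: "set xs = UNIV" "distinct xs"
begin

definition clean :: "'s list \<Rightarrow> 's list" where "clean w = filter (\<lambda>s. s \<notin> B) w"

text \<open>Blocks that become empty are dropped; otherwise one terminator for each of the
  exponentially many paths would remain on the tape.\<close>

definition sec_blocks :: "'x \<Rightarrow> 's list list \<Rightarrow> 's list list" where
  "sec_blocks x bs = filter (\<lambda>c. c \<noteq> []) (map (\<lambda>b. clean (word_sec trn otp b x)) bs)"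

definition next_level :: "'s list list \<Rightarrow> 's list list" where
  "next_level bs = concat (map (\<lambda>x. sec_blocks x bs) xs)"

text \<open>The letter register carries x through the block, so at the terminator it holds the image
  of x under the whole block. Stack 3 keeps what was read, for the pass with the next
  letter.\<close>

definition sec_body :: "'x \<Rightarrow> (('s, 'x) store, 's option) com" where
  "sec_body x = Seq (Push 3 (\<lambda>(a, _). the a)) (Cond (\<lambda>(a, _). a = Some None)
     (Seq (Cond (\<lambda>(_, _, ne, _). ne) (Push 2 (\<lambda>_. None)) (Upd id))
       (Upd (\<lambda>(a, y, ne, ok). (a, x, False, ok \<and> y = x))))
     (Seq (Cond (\<lambda>(a, y, _). trn (the (the a)) y \<notin> B)
         (Seq (Push 2 (\<lambda>(a, y, _). Some (trn (the (the a)) y))) (Upd (\<lambda>(a, y, _, ok). (a, y, True, ok))))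
         (Upd id))
       (Upd (\<lambda>(a, y, ne, ok). (a, otp (the (the a)) y, ne, ok)))))"

lemma sec_body_letter:
  "runs (sec_body x) ((Some (Some s), y, ne, ok), stk I A C A' K L U) 12
    ((Some (Some s), otp s y, ne \<or> trn s y \<notin> B, ok),
     stk I A (if trn s y \<in> B then C else Some (trn s y) # C) (Some s # A') K L U)"
  by (rule runs_ev) (auto simp: sec_body_def)

lemma sec_body_end:
  "runs (sec_body x) ((Some None, y, ne, ok), stk I A C A' K L U) 12
    ((Some None, x, False, ok \<and> y = x), stk I A (if ne then None # C else C) (None # A') K L U)"
  by (rule runs_ev) (auto simp: sec_body_def)

lemma clean_simps [simp]: "clean [] = []" "clean (s # w) = (if s \<in> B then clean w else s # clean w)"
  by (simp_all add: clean_def)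

text \<open>A run that starts behind the block is extended backwards over it, because the loop runs
  over symbols and does not see block boundaries. The flag \<open>ne\<close> tells whether an
  earlier part of the block has already produced output.\<close>

lemma sec_pass_block:
  assumes "runs (foreach 1 (sec_body x)) ((Some None, x, False, ok \<and> fold otp b y = x),
      stk I A (if ne \<or> clean (word_sec trn otp b y) \<noteq> []
               then None # rev (map Some (clean (word_sec trn otp b y))) @ C else C)
        (None # rev (map Some b) @ A') K L U) T s"
  shows "runs (foreach 1 (sec_body x)) ((a, y, ne, ok), stk I (map Some b @ None # A) C A' K L U)
    (15 * (length b + 1) + T) s"
  using assms
proof (induction b arbitrary: a y ne C A')
  case Nil
  have "runs (foreach 1 (sec_body x)) ((a, y, ne, ok), stk I (None # A) C A' K L U) (12 + T + 3) s"
  proof (rule runs_foreach_Cons)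
    show "stk I (None # A) C A' K L U 1 = None # A" by simp
    show "runs (sec_body x) ((Some None, y, ne, ok), (stk I (None # A) C A' K L U)(1 := A)) 12
      ((Some None, x, False, ok \<and> y = x), stk I A (if ne then None # C else C) (None # A') K L U)"
      using sec_body_end by simp
    show "runs (foreach 1 (sec_body x)) ((Some None, x, False, ok \<and> y = x),
      stk I A (if ne then None # C else C) (None # A') K L U) T s"
      using Nil by (cases ne) simp_all
  qed
  then show ?case by (simp add: add.commute)
next
  case (Cons t b)
  have "runs (foreach 1 (sec_body x)) ((a, y, ne, ok), stk I (Some t # map Some b @ None # A) C A' K L U)
    (12 + (15 * (length b + 1) + T) + 3) s"
  proof (rule runs_foreach_Cons)
    show "stk I (Some t # map Some b @ None # A) C A' K L U 1 = Some t # map Some b @ None # A" by simp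
    show "runs (sec_body x) ((Some (Some t), y, ne, ok),
        (stk I (Some t # map Some b @ None # A) C A' K L U)(1 := map Some b @ None # A)) 12
      ((Some (Some t), otp t y, ne \<or> trn t y \<notin> B, ok),
       stk I (map Some b @ None # A) (if trn t y \<in> B then C else Some (trn t y) # C) (Some t # A') K L U)"
      using sec_body_letter by simp
    show "runs (foreach 1 (sec_body x)) ((Some (Some t), otp t y, ne \<or> trn t y \<notin> B, ok),
       stk I (map Some b @ None # A) (if trn t y \<in> B then C else Some (trn t y) # C) (Some t # A') K L U)
       (15 * (length b + 1) + T) s"
      using Cons.prems by (intro Cons.IH) (auto split: if_splits)
  qed
  from runs_mono[OF this, of "15 * (length (t # b) + 1) + T"] show ?case by simp
qed

lemma sec_pass_blocks:
  "runs (foreach 1 (sec_body x)) ((a, x, False, ok), stk I (enc_blocks bs) C A' K L U)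
    (15 * length (enc_blocks bs) + 3)
    ((None, x, False, ok \<and> (\<forall>b\<in>set bs. fold otp b x = x)),
     stk I [] (rev (enc_blocks (sec_blocks x bs)) @ C) (rev (enc_blocks bs) @ A') K L U)"
proof (induction bs arbitrary: a ok C A')
  case Nil
  show ?case using runs_foreach_Nil[of "stk I [] C A' K L U" 1] by (simp add: sec_blocks_def)
next
  case (Cons b bs)
  let ?c = "clean (word_sec trn otp b x)"
  have "runs (foreach 1 (sec_body x)) ((a, x, False, ok), stk I (map Some b @ None # enc_blocks bs) C A' K L U)
    (15 * (length b + 1) + (15 * length (enc_blocks bs) + 3))
    ((None, x, False, (ok \<and> fold otp b x = x) \<and> (\<forall>b\<in>set bs. fold otp b x = x)),
     stk I [] (rev (enc_blocks (sec_blocks x bs)) @ (if False \<or> ?c \<noteq> [] then None # rev (map Some ?c) @ C else C))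
      (rev (enc_blocks bs) @ None # rev (map Some b) @ A') K L U)"
    by (intro sec_pass_block Cons.IH)
  moreover have "rev (enc_blocks (sec_blocks x bs)) @ (if False \<or> ?c \<noteq> [] then None # rev (map Some ?c) @ C else C)
    = rev (enc_blocks (sec_blocks x (b # bs))) @ C"
    by (simp add: sec_blocks_def)
  moreover have "rev (map Some b @ None # enc_blocks bs) @ A' = rev (enc_blocks bs) @ None # rev (map Some b) @ A'"
    by simp
  ultimately show ?case by (simp add: conj_assoc algebra_simps del: rev_append)
qed

definition sec_pass :: "'x \<Rightarrow> (('s, 'x) store, 's option) com" where
  "sec_pass x = Seq (Upd (\<lambda>(a, y, ne, ok). (a, x, False, ok))) (Seq (foreach 1 (sec_body x)) (move 3 1))"

lemma runs_sec_pass: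
  "runs (sec_pass x) ((a, y, ne, ok), stk I (enc_blocks bs) C [] K L U) (20 * length (enc_blocks bs) + 9)
    ((None, x, False, ok \<and> (\<forall>b\<in>set bs. fold otp b x = x)),
     stk I (enc_blocks bs) (rev (enc_blocks (sec_blocks x bs)) @ C) [] K L U)"
proof -
  have 1: "runs (Upd (\<lambda>(a, y, ne, ok). (a, x, False, ok))) ((a, y, ne, ok), S) 1 ((a, x, False, ok), S)" for S
    by (rule runs_ev) auto
  have 3: "runs (move 3 1) ((None, x, False, ok'), stk I [] C' (rev (enc_blocks bs) @ []) K L U)
    (5 * length (enc_blocks bs) + 3) ((None, x, False, ok'), stk I (enc_blocks bs) C' [] K L U)" for ok' C'
    using runs_move[of 3 1 None "(x, False, ok')" "stk I [] C' (rev (enc_blocks bs) @ []) K L U"] by simp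
  show ?thesis unfolding sec_pass_def
    by (rule runs_mono[OF runs_Seq[OF 1 runs_Seq[OF sec_pass_blocks 3]]]) simp
qed

lemma runs_sec_passes:
  "\<exists>v. runs (seqs (map sec_pass ys)) ((a, y, ne, ok), stk I (enc_blocks bs) C [] K L U)
    (length ys * (20 * length (enc_blocks bs) + 10) + 1)
    ((fst v, fst (snd v), snd (snd v), ok \<and> (\<forall>x\<in>set ys. \<forall>b\<in>set bs. fold otp b x = x)),
     stk I (enc_blocks bs) (rev (enc_blocks (concat (map (\<lambda>x. sec_blocks x bs) ys))) @ C) [] K L U)"
proof (induction ys arbitrary: a y ne ok C)
  case Nil
  show ?case using runs_seqs_Nil by (intro exI[of _ "(a, y, ne)"]) simp
next
  case (Cons x ys)
  from Cons[of None x False "ok \<and> (\<forall>b\<in>set bs. fold otp b x = x)" "rev (enc_blocks (sec_blocks x bs)) @ C"]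
  obtain v where "runs (seqs (map sec_pass ys)) ((None, x, False, ok \<and> (\<forall>b\<in>set bs. fold otp b x = x)),
      stk I (enc_blocks bs) (rev (enc_blocks (sec_blocks x bs)) @ C) [] K L U)
    (length ys * (20 * length (enc_blocks bs) + 10) + 1)
    ((fst v, fst (snd v), snd (snd v), (ok \<and> (\<forall>b\<in>set bs. fold otp b x = x)) \<and> (\<forall>x\<in>set ys. \<forall>b\<in>set bs. fold otp b x = x)),
     stk I (enc_blocks bs) (rev (enc_blocks (concat (map (\<lambda>x. sec_blocks x bs) ys))) @ rev (enc_blocks (sec_blocks x bs)) @ C) [] K L U)"
    by blast
  from runs_seqs_Cons[OF runs_sec_pass this] show ?case
    by (intro exI[of _ v]) (simp add: conj_assoc algebra_simps)
qed

definition level :: "(('s, 'x) store, 's option) com" where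
  "level = Seq (seqs (map sec_pass xs)) (Seq (drain 1) (move 2 1))"

definition level_cost :: "'s list list \<Rightarrow> nat" where
  "level_cost bs = (20 * length xs + 4) * length (enc_blocks bs) + 5 * length (enc_blocks (next_level bs))
     + 10 * length xs + 9"

definition fixes_letters :: "'s list list \<Rightarrow> bool" where
  "fixes_letters bs \<longleftrightarrow> (\<forall>x. \<forall>b\<in>set bs. fold otp b x = x)"

lemma runs_level:
  "\<exists>v. runs level ((a, y, ne, ok), stk I (enc_blocks bs) [] [] K L U) (level_cost bs)
    ((None, fst v, snd v, ok \<and> fixes_letters bs), stk I (enc_blocks (next_level bs)) [] [] K L U)"
proof -
  let ?E = "enc_blocks (next_level bs)"
  obtain v where 1: "runs (seqs (map sec_pass xs)) ((a, y, ne, ok), stk I (enc_blocks bs) [] [] K L U)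
      (length xs * (20 * length (enc_blocks bs) + 10) + 1)
      ((fst v, fst (snd v), snd (snd v), ok \<and> fixes_letters bs), stk I (enc_blocks bs) (rev ?E) [] K L U)"
    using runs_sec_passes[of xs a y ne ok I bs "[]" K L U] xs(1)
    by (auto simp: fixes_letters_def next_level_def)
  have 2: "runs (drain 1) ((fst v, fst (snd v), snd (snd v), ok'), stk I (enc_blocks bs) (rev ?E) [] K L U)
    (4 * length (enc_blocks bs) + 3) ((None, fst (snd v), snd (snd v), ok'), stk I [] (rev ?E) [] K L U)" for ok'
    using runs_drain[of 1 "fst v" "(fst (snd v), snd (snd v), ok')" "stk I (enc_blocks bs) (rev ?E) [] K L U"]
    by simp
  have 3: "runs (move 2 1) ((None, fst (snd v), snd (snd v), ok'), stk I [] (rev ?E) [] K L U)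
    (5 * length ?E + 3) ((None, fst (snd v), snd (snd v), ok'), stk I ?E [] [] K L U)" for ok'
    using runs_move[of 2 1 None "(fst (snd v), snd (snd v), ok')" "stk I [] (rev ?E) [] K L U"]
    by simp
  show ?thesis unfolding level_def
    by (intro exI[of _ "snd v"] runs_mono[OF runs_Seq[OF 1 runs_Seq[OF 2 3]]])
      (simp add: level_cost_def algebra_simps)
qed

lemma runs_levels:
  "\<exists>v. runs (foreach 4 level) ((a, y, ne, ok), stk I (enc_blocks bs) [] [] (replicate D None) L U)
    ((\<Sum>k<D. level_cost ((next_level ^^ k) bs) + 3) + 3)
    ((None, fst v, snd v, ok \<and> (\<forall>k<D. fixes_letters ((next_level ^^ k) bs))),
     stk I (enc_blocks ((next_level ^^ D) bs)) [] [] [] L U)"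
proof (induction D arbitrary: a y ne ok bs)
  case 0
  show ?case using runs_foreach_Nil[of "stk I (enc_blocks bs) [] [] [] L U" 4]
    by (intro exI[of _ "(y, ne)"]) simp
next
  case (Suc D)
  let ?S = "stk I (enc_blocks bs) [] [] (replicate (Suc D) None) L U"
  obtain v where v: "runs level ((Some None, y, ne, ok), ?S(4 := replicate D None)) (level_cost bs)
    ((None, fst v, snd v, ok \<and> fixes_letters bs), stk I (enc_blocks (next_level bs)) [] [] (replicate D None) L U)"
    using runs_level by fastforce
  obtain v' where v': "runs (foreach 4 level) ((None, fst v, snd v, ok \<and> fixes_letters bs),
      stk I (enc_blocks (next_level bs)) [] [] (replicate D None) L U)
    ((\<Sum>k<D. level_cost ((next_level ^^ k) (next_level bs)) + 3) + 3)
    ((None, fst v', snd v', (ok \<and> fixes_letters bs) \<and> (\<forall>k<D. fixes_letters ((next_level ^^ k) (next_level bs)))),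
     stk I (enc_blocks ((next_level ^^ D) (next_level bs))) [] [] [] L U)"
    using Suc by blast
  have "?S 4 = None # replicate D None" by simp
  from runs_foreach_Cons[of ?S 4, OF this v v'] show ?case
    by (intro exI[of _ v'])
      (simp add: funpow_swap1 sum.lessThan_Suc_shift All_less_Suc2 conj_assoc comp_def algebra_simps del: sum.lessThan_Suc)
qed

section \<open>Unary arithmetic for the clock\<close>

abbreviation ones :: "nat \<Rightarrow> 's option list" where "ones n \<equiv> replicate n None"

definition halve_body :: "(('s, 'x) store, 's option) com" where
  "halve_body = Seq (Pop 2 (\<lambda>(_, v) a. (a, v))) (Cond (\<lambda>(a, _). a \<noteq> None) (Push 3 (\<lambda>_. None)) (Upd id))"

lemma runs_halve:
  "runs (foreach 2 halve_body) ((a, v), stk I A (ones u) (ones m) K L U) (10 * u + 3)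
    ((None, v), stk I A [] (ones (m + u div 2)) K L U)"
proof (induction u arbitrary: a m rule: induct_nat_012)
  case 0
  show ?case using runs_foreach_Nil[of "stk I A [] (ones m) K L U" 2] by simp
next
  case 1
  have S: "stk I A (ones (Suc 0)) (ones m) K L U 2 = None # []" by simp
  have 1: "runs halve_body ((Some None, v), (stk I A (ones (Suc 0)) (ones m) K L U)(2 := [])) 4
    ((None, v), stk I A [] (ones m) K L U)"
    by (rule runs_ev) (auto simp: halve_body_def)
  have 2: "runs (foreach 2 halve_body) ((None, v), stk I A [] (ones m) K L U) 3 ((None, v), stk I A [] (ones m) K L U)"
    using runs_foreach_Nil[of "stk I A [] (ones m) K L U" 2] by simp
  show ?case
    using runs_mono[OF runs_foreach_Cons[of _ 2, OF S 1 2, of a], of "10 * Suc 0 + 3"] by simp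
next
  case (ge2 u)
  have S: "stk I A (ones (Suc (Suc u))) (ones m) K L U 2 = None # ones (Suc u)" by simp
  have 1: "runs halve_body ((Some None, v), (stk I A (ones (Suc (Suc u))) (ones m) K L U)(2 := ones (Suc u))) 5
    ((Some None, v), stk I A (ones u) (ones (Suc m)) K L U)"
    by (rule runs_ev) (auto simp: halve_body_def)
  show ?case
    using runs_mono[OF runs_foreach_Cons[of _ 2, OF S 1 ge2.IH(1)[of "Some None" "Suc m"], of a], of "10 * Suc (Suc u) + 3"] by simp
qed

definition round_body :: "(('s, 'x) store, 's option) com" where
  "round_body = Seq (Push 5 (\<lambda>_. None)) (Seq (foreach 2 halve_body) (move 3 2))"

lemma runs_round:
  "runs round_body ((a, v), stk I A (ones u) [] K (ones l) U) (13 * u + 10)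
    ((None, v), stk I A (ones (u div 2)) [] K (ones (Suc l)) U)"
proof -
  have 1: "runs (Push 5 (\<lambda>_. None)) ((a, v), stk I A (ones u) [] K (ones l) U) 2
    ((a, v), stk I A (ones u) (ones 0) K (ones (Suc l)) U)"
    by (rule runs_ev) auto
  have 3: "runs (move 3 2) ((None, v), stk I A [] (ones (0 + u div 2)) K (ones (Suc l)) U) (5 * (u div 2) + 3)
    ((None, v), stk I A (ones (u div 2)) [] K (ones (Suc l)) U)"
    using runs_move[of 3 2 None v "stk I A [] (ones (u div 2)) K (ones (Suc l)) U"] by simp
  show ?thesis unfolding round_body_def
    by (rule runs_mono[OF runs_Seq[OF 1 runs_Seq[OF runs_halve 3]]]) simp
qed

text \<open>A round costs time linear in the current value, which is then halved, so the costs form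
  a geometric sum and the logarithm is found in linear time.\<close>

lemma runs_log:
  "runs (foreach 2 round_body) ((a, v), stk I A (ones u) [] K (ones l) U) (40 * u + 3)
    ((None, v), stk I A [] [] K (ones (half_rounds u + l)) U)"
proof (induction u arbitrary: a l rule: half_rounds.induct)
  case 1
  show ?case using runs_foreach_Nil[of "stk I A [] [] K (ones l) U" 2] by simp
next
  case (2 u)
  have S: "stk I A (ones (Suc u)) [] K (ones l) U 2 = None # ones u" by simp
  have 1: "runs round_body ((Some None, v), (stk I A (ones (Suc u)) [] K (ones l) U)(2 := ones u)) (13 * u + 10)
    ((None, v), stk I A (ones (u div 2)) [] K (ones (Suc l)) U)"
    using runs_round by simp
  show ?case
    using runs_mono[OF runs_foreach_Cons[of _ 2, OF S 1 "2.IH"[of None "Suc l"], of a], of "40 * Suc u + 3"] by simp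
qed

definition add_body :: "(('s, 'x) store, 's option) com" where
  "add_body = Seq (Push 6 (\<lambda>_. None)) (Push 2 (\<lambda>_. None))"

lemma runs_add:
  "runs (foreach 5 add_body) ((a, v), stk I A (ones p) T K (ones l) (ones m)) (8 * l + 3)
    ((None, v), stk I A (ones (l + p)) T K [] (ones (l + m)))"
proof (induction l arbitrary: a p m)
  case 0
  show ?case using runs_foreach_Nil[of "stk I A (ones p) T K [] (ones m)" 5] by simp
next
  case (Suc l)
  have S: "stk I A (ones p) T K (ones (Suc l)) (ones m) 5 = None # ones l" by simp
  have 1: "runs add_body ((Some None, v), (stk I A (ones p) T K (ones (Suc l)) (ones m))(5 := ones l)) 5
    ((Some None, v), stk I A (ones (Suc p)) T K (ones l) (ones (Suc m)))"
    by (rule runs_ev) (auto simp: add_body_def)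
  show ?case
    using runs_mono[OF runs_foreach_Cons[of _ 5, OF S 1 Suc[of "Some None" "Suc p" "Suc m"], of a], of "8 * Suc l + 3"] by simp
qed

definition mult_body :: "(('s, 'x) store, 's option) com" where
  "mult_body = Seq (foreach 5 add_body) (move 6 5)"

lemma runs_mult_loop:
  "runs (foreach 4 mult_body) ((a, v), stk I A (ones p) T (ones k) (ones l) []) (k * (13 * l + 10) + 3)
    ((None, v), stk I A (ones (k * l + p)) T [] (ones l) [])"
proof (induction k arbitrary: a p)
  case 0
  show ?case using runs_foreach_Nil[of "stk I A (ones p) T [] (ones l) []" 4] by simp
next
  case (Suc k)
  have S: "stk I A (ones p) T (ones (Suc k)) (ones l) [] 4 = None # ones k" by simp
  have 2: "runs (move 6 5) ((None, v), stk I A (ones (l + p)) T (ones k) [] (ones (l + 0))) (5 * l + 3)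
    ((None, v), stk I A (ones (l + p)) T (ones k) (ones l) [])"
    using runs_move[of 6 5 None v "stk I A (ones (l + p)) T (ones k) [] (ones (l + 0))"] by simp
  have 1: "runs mult_body ((Some None, v), (stk I A (ones p) T (ones (Suc k)) (ones l) [])(4 := ones k)) (13 * l + 7)
    ((None, v), stk I A (ones (l + p)) T (ones k) (ones l) [])"
    using runs_mono[OF runs_Seq[OF runs_add[of "Some None" v I A p T "ones k" l 0] 2], of "13 * l + 7"]
    by (simp add: mult_body_def)
  show ?case
    using runs_mono[OF runs_foreach_Cons[of _ 4, OF S 1 Suc[of None "l + p"], of a], of "Suc k * (13 * l + 10) + 3"] by (simp add: algebra_simps)
qed

definition mult :: "(('s, 'x) store, 's option) com" where
  "mult = Seq (foreach 4 mult_body) (move 2 4)"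

lemma runs_mult:
  "runs mult ((a, v), stk I A [] T (ones k) (ones l) []) (k * (18 * l + 10) + 7)
    ((None, v), stk I A [] T (ones (k * l)) (ones l) [])"
proof -
  have 2: "runs (move 2 4) ((None, v), stk I A (ones (k * l + 0)) T [] (ones l) []) (5 * (k * l) + 3)
    ((None, v), stk I A [] T (ones (k * l)) (ones l) [])"
    using runs_move[of 2 4 None v "stk I A (ones (k * l)) T [] (ones l) []"] by simp
  show ?thesis unfolding mult_def
    by (rule runs_mono[OF runs_Seq[OF runs_mult_loop[of a v I A 0 T k l, simplified] 2[simplified]]])
      (simp add: algebra_simps)
qed

text \<open>For l >= 1 no intermediate product exceeds the final one, so computing the clock costs
  only a constant multiple of its value when r is fixed.\<close>

lemma runs_power:
  assumes "1 \<le> l"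
  shows "\<exists>a'. runs (seqs (replicate r mult)) ((a, v), stk I A [] T (ones k) (ones l) [])
    (r * (28 * (k * l ^ r) + 8) + 1) ((a', v), stk I A [] T (ones (k * l ^ r)) (ones l) [])"
proof (induction r arbitrary: a k)
  case 0
  show ?case using runs_seqs_Nil by (intro exI[of _ a]) simp
next
  case (Suc r)
  from Suc[of None "k * l"] obtain a' where
    "runs (seqs (replicate r mult)) ((None, v), stk I A [] T (ones (k * l)) (ones l) [])
      (r * (28 * (k * l * l ^ r) + 8) + 1) ((a', v), stk I A [] T (ones (k * l * l ^ r)) (ones l) [])" by blast
  from runs_seqs_Cons[OF runs_mult this] have
    "runs (seqs (replicate (Suc r) mult)) ((a, v), stk I A [] T (ones k) (ones l) [])
      (Suc (k * (18 * l + 10) + 7 + (r * (28 * (k * l * l ^ r) + 8) + 1)))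
      ((a', v), stk I A [] T (ones (k * l ^ Suc r)) (ones l) [])" by (simp add: mult.assoc)
  moreover have "k * (18 * l + 10) \<le> 28 * (k * l ^ Suc r)"
  proof -
    have "k * (18 * l + 10) \<le> k * (28 * l ^ Suc r)"
    proof (intro mult_le_mono2)
      have "l * 1 \<le> l * l ^ r" using assms by (intro mult_le_mono2) auto
      then show "18 * l + 10 \<le> 28 * l ^ Suc r" using assms unfolding power_Suc by linarith
    qed
    then show ?thesis by simp
  qed
  ultimately show ?case by (intro exI[of _ a']) (erule runs_mono, simp add: algebra_simps)
qed

lemma runs_pushes:
  "runs (seqs (replicate c (Push 4 (\<lambda>_. None)))) ((a, v), stk I A C T (ones k) L U) (3 * c + 1)
    ((a, v), stk I A C T (ones (c + k)) L U)"
proof (induction c arbitrary: k)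
  case 0
  show ?case using runs_seqs_Nil by simp
next
  case (Suc c)
  have "runs (Push 4 (\<lambda>_. None)) ((a, v), stk I A C T (ones k) L U) 2 ((a, v), stk I A C T (ones (Suc k)) L U)"
    by (rule runs_ev) auto
  from runs_mono[OF runs_seqs_Cons[OF this Suc[of "Suc k"]], of "3 * Suc c + 1"] show ?case by simp
qed

definition copy_body :: "(('s, 'x) store, 's option) com" where
  "copy_body = Seq (Push 3 (\<lambda>(a, _). the a)) (Push 2 (\<lambda>_. None))"

lemma runs_copy:
  "runs (foreach 0 copy_body) ((a, v), stk I A (ones m) T K L U) (8 * length I + 3)
    ((None, v), stk [] A (ones (length I + m)) (rev I @ T) K L U)"
proof (induction I arbitrary: a m T)
  case Nil
  show ?case using runs_foreach_Nil[of "stk [] A (ones m) T K L U" 0] by simp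
next
  case (Cons s I)
  have S: "stk (s # I) A (ones m) T K L U 0 = s # I" by simp
  have 1: "runs copy_body ((Some s, v), (stk (s # I) A (ones m) T K L U)(0 := I)) 5
    ((Some s, v), stk I A (ones (Suc m)) (s # T) K L U)"
    by (rule runs_ev) (auto simp: copy_body_def)
  show ?case
    using runs_mono[OF runs_foreach_Cons[of _ 0, OF S 1 Cons[of "Some s" "Suc m" "s # T"], of a], of "8 * length (s # I) + 3"] by simp
qed

text \<open>The \<open>None\<close> pushed first terminates the single block w of level 0. The two
  units pushed on stack 5 are the + 2 in \<open>clock_value\<close>.\<close>

definition wp_program :: "nat \<Rightarrow> nat \<Rightarrow> (('s, 'x) store, 's option) com" where
  "wp_program c r = Seq (Push 1 (\<lambda>_. None)) (Seq (foreach 0 copy_body) (Seq (move 3 1)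
     (Seq (Push 5 (\<lambda>_. None)) (Seq (Push 5 (\<lambda>_. None)) (Seq (foreach 2 round_body)
     (Seq (seqs (replicate c (Push 4 (\<lambda>_. None)))) (Seq (seqs (replicate r mult)) (foreach 4 level))))))))"

lemma stacks_below_wp_program: "stacks_below 7 (wp_program c r)"
proof -
  have seqs: "(\<And>c. c \<in> set cs \<Longrightarrow> stacks_below 7 c) \<Longrightarrow> stacks_below 7 (seqs cs)"
    for cs :: "(('s, 'x) store, 's option) com list" by (induction cs) auto
  show ?thesis
    by (auto simp: wp_program_def foreach_def move_def drain_def copy_body_def round_body_def halve_body_def
        mult_def mult_body_def add_body_def level_def sec_pass_def sec_body_def intro!: seqs)
qed

definition total_cost :: "nat \<Rightarrow> nat \<Rightarrow> 's list \<Rightarrow> nat" where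
  "total_cost c r w = 53 * length w + 3 * c + r * (28 * clock_value c r (length w) + 8) + 30
     + (\<Sum>k<clock_value c r (length w). level_cost ((next_level ^^ k) [w]) + 3)"

lemma runs_wp_program:
  "\<exists>q S. runs (wp_program c r) ((None, y, ne, True), (\<lambda>_. [])(0 := map Some w)) (total_cost c r w) (q, S) \<and>
    (snd (snd (snd q)) \<longleftrightarrow> (\<forall>k<clock_value c r (length w). fixes_letters ((next_level ^^ k) [w])))"
proof -
  let ?n = "length w" and ?v = "(y, ne, True)"
  let ?D = "clock_value c r ?n" and ?I = "map Some w"
  have init: "(\<lambda>_. [])(0 := ?I) = stk ?I [] [] [] [] [] []" by (auto simp: stk_def)
  have 1: "runs (Push 1 (\<lambda>_. None)) ((None, ?v), stk ?I [] [] [] [] [] []) 2 ((None, ?v), stk ?I [None] (ones 0) [] [] [] [])"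
    by (rule runs_ev) auto
  have 2: "runs (foreach 0 copy_body) ((None, ?v), stk ?I [None] (ones 0) [] [] [] []) (8 * ?n + 3)
    ((None, ?v), stk [] [None] (ones ?n) (rev ?I) [] [] [])"
    using runs_copy[of None ?v ?I "[None]" 0 "[]" "[]" "[]" "[]"] by simp
  have 3: "runs (move 3 1) ((None, ?v), stk [] [None] (ones ?n) (rev ?I) [] [] []) (5 * ?n + 3)
    ((None, ?v), stk [] (enc_blocks [w]) (ones ?n) [] [] [] [])"
    using runs_move[of 3 1 None ?v "stk [] [None] (ones ?n) (rev ?I) [] [] []"] by simp
  have 4: "runs (Push 5 (\<lambda>_. None)) ((None, ?v), stk [] (enc_blocks [w]) (ones ?n) [] [] [] []) 2
    ((None, ?v), stk [] (enc_blocks [w]) (ones ?n) [] [] (ones 1) [])"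
    by (rule runs_ev) auto
  have 5: "runs (Push 5 (\<lambda>_. None)) ((None, ?v), stk [] (enc_blocks [w]) (ones ?n) [] [] (ones 1) []) 2
    ((None, ?v), stk [] (enc_blocks [w]) (ones ?n) [] (ones 0) (ones 2) [])"
    by (rule runs_ev) (auto simp: numeral_2_eq_2)
  let ?l = "half_rounds ?n + 2"
  have 6: "runs (foreach 2 round_body) ((None, ?v), stk [] (enc_blocks [w]) (ones ?n) [] (ones 0) (ones 2) []) (40 * ?n + 3)
    ((None, ?v), stk [] (enc_blocks [w]) [] [] (ones 0) (ones ?l) [])"
    by (rule runs_log)
  have 7: "runs (seqs (replicate c (Push 4 (\<lambda>_. None)))) ((None, ?v), stk [] (enc_blocks [w]) [] [] (ones 0) (ones ?l) []) (3 * c + 1)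
    ((None, ?v), stk [] (enc_blocks [w]) [] [] (ones c) (ones ?l) [])"
    using runs_pushes[of c None ?v "[]" "enc_blocks [w]" "[]" "[]" 0] by simp
  obtain a' where 8: "runs (seqs (replicate r mult)) ((None, ?v), stk [] (enc_blocks [w]) [] [] (ones c) (ones ?l) [])
    (r * (28 * ?D + 8) + 1) ((a', ?v), stk [] (enc_blocks [w]) [] [] (ones ?D) (ones ?l) [])"
    using runs_power[of ?l r None ?v "[]" "enc_blocks [w]" "[]" c] unfolding clock_value_def by auto
  obtain v where 9: "runs (foreach 4 level) ((a', ?v), stk [] (enc_blocks [w]) [] [] (ones ?D) (ones ?l) [])
    ((\<Sum>k<?D. level_cost ((next_level ^^ k) [w]) + 3) + 3)
    ((None, fst v, snd v, True \<and> (\<forall>k<?D. fixes_letters ((next_level ^^ k) [w]))),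
     stk [] (enc_blocks ((next_level ^^ ?D) [w])) [] [] [] (ones ?l) [])"
    using runs_levels by blast
  have "runs (wp_program c r) ((None, ?v), stk ?I [] [] [] [] [] []) (total_cost c r w)
    ((None, fst v, snd v, True \<and> (\<forall>k<?D. fixes_letters ((next_level ^^ k) [w]))),
     stk [] (enc_blocks ((next_level ^^ ?D) [w])) [] [] [] (ones ?l) [])"
    unfolding wp_program_def
    by (rule runs_mono[OF runs_Seq[OF 1 runs_Seq[OF 2 runs_Seq[OF 3 runs_Seq[OF 4 runs_Seq[OF 5
        runs_Seq[OF 6 runs_Seq[OF 7 runs_Seq[OF 8 9]]]]]]]]]) (simp add: total_cost_def)
  then show ?thesis unfolding init by fastforce
qed

end

section \<open>Total length of the levels and correctness of the test\<close>

context section_program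
begin

abbreviation "esc \<equiv> escape_count trn B"

text \<open>A potential: it counts the nontrivial sections that the letters of a level will have k
  levels further down.\<close>

definition weight :: "nat \<Rightarrow> 's list list \<Rightarrow> nat" where
  "weight k bs = (\<Sum>b\<leftarrow>bs. \<Sum>s\<leftarrow>b. esc s k)"

lemma esc_trivial: "s \<in> B \<Longrightarrow> esc s k = 0"
  by (induction k) (auto simp: trivial)

lemma sum_esc_clean: "(\<Sum>s\<leftarrow>clean w. esc s k) = (\<Sum>s\<leftarrow>w. esc s k)"
  by (induction w) (auto simp: esc_trivial)

text \<open>A letter of the word reads the image of x under the letters before it. As x runs through
  all letters so does this image, and each letter meets every x exactly once.\<close>

lemma sum_esc_sec: "(\<Sum>x\<in>UNIV. \<Sum>s\<leftarrow>word_sec trn otp w x. esc s k) = (\<Sum>s\<leftarrow>w. esc s (Suc k))"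
proof (induction w)
  case (Cons s w)
  have "(\<Sum>x\<in>UNIV. \<Sum>s\<leftarrow>word_sec trn otp w (otp s x). esc s k) = (\<Sum>x\<in>UNIV. \<Sum>s\<leftarrow>word_sec trn otp w x. esc s k)"
    using otp_bij[of s] by (rule sum.reindex_bij_betw)
  with Cons show ?case by (simp add: sum.distrib)
qed simp

lemma weight_sec_blocks: "weight k (sec_blocks x bs) = (\<Sum>b\<leftarrow>bs. \<Sum>s\<leftarrow>word_sec trn otp b x. esc s k)"
proof (induction bs)
  case (Cons b bs)
  have "(\<Sum>s\<leftarrow>word_sec trn otp b x. esc s k) = (\<Sum>s\<leftarrow>clean (word_sec trn otp b x). esc s k)"
    by (simp add: sum_esc_clean)
  with Cons show ?case by (auto simp: weight_def sec_blocks_def)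
qed (simp add: weight_def sec_blocks_def)

lemma weight_next_level: "weight k (next_level bs) = weight (Suc k) bs"
proof -
  have "weight k (next_level bs) = (\<Sum>x\<leftarrow>xs. weight k (sec_blocks x bs))"
    unfolding next_level_def by (induction xs) (auto simp: weight_def)
  also have "\<dots> = (\<Sum>x\<in>UNIV. \<Sum>b\<leftarrow>bs. \<Sum>s\<leftarrow>word_sec trn otp b x. esc s k)"
    using xs by (simp add: sum_list_distinct_conv_sum_set weight_sec_blocks)
  also have "\<dots> = weight (Suc k) bs"
    by (induction bs) (simp_all add: weight_def sum.distrib sum_esc_sec del: escape_count.simps)
  finally show ?thesis .
qed

lemma weight_iterate: "weight j ((next_level ^^ k) bs) = weight (k + j) bs"
  by (induction k arbitrary: j) (auto simp: weight_next_level)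

text \<open>Every letter outside \<open>B\<close> has weight one, and since blocks are nonempty the
  terminators at most double the length.\<close>

lemma length_enc_blocks_le:
  assumes "\<And>b. b \<in> set bs \<Longrightarrow> b \<noteq> [] \<and> set b \<inter> B = {}"
  shows "length (enc_blocks bs) \<le> 2 * weight 0 bs"
  using assms
proof (induction bs)
  case (Cons b bs)
  have "length b = (\<Sum>s\<leftarrow>b. esc s 0)" if "set b \<inter> B = {}"
    using that by (induction b) auto
  moreover have "1 \<le> length b" "set b \<inter> B = {}" using Cons.prems[of b] by (auto simp: Suc_le_eq)
  ultimately show ?case using Cons by (simp add: weight_def)
qed (simp add: weight_def)

text \<open>The summand \<open>length w + 1\<close> is for level 0 only, where the input has not
  been cleaned of trivial letters.\<close>

lemma length_level_le:
  "length (enc_blocks ((next_level ^^ k) [w])) \<le> 2 * (\<Sum>s\<leftarrow>w. esc s k) + length w + 1"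
proof (cases k)
  case (Suc j)
  have "length (enc_blocks ((next_level ^^ k) [w])) \<le> 2 * weight 0 ((next_level ^^ k) [w])"
    by (rule length_enc_blocks_le) (auto simp: Suc next_level_def sec_blocks_def clean_def)
  also have "\<dots> = 2 * (\<Sum>s\<leftarrow>w. esc s k)" by (simp only: weight_iterate) (simp add: weight_def)
  finally show ?thesis by simp
qed simp

lemma word_act_clean: "word_act trn otp (clean w) v = word_act trn otp w v"
proof -
  have "aut_out trn otp s v = v" if "s \<in> B" for s v
    using that by (induction v) (auto simp: trivial)
  then show ?thesis by (induction w arbitrary: v) auto
qed

definition fixes_depth :: "nat \<Rightarrow> 's list list \<Rightarrow> bool" where
  "fixes_depth D bs \<longleftrightarrow> (\<forall>b\<in>set bs. \<forall>v. length v = D \<longrightarrow> word_act trn otp b v = v)"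

lemma fixes_depth_Suc: "fixes_depth (Suc D) bs \<longleftrightarrow> fixes_letters bs \<and> fixes_depth D (next_level bs)"
proof
  assume *: "fixes_depth (Suc D) bs"
  have step: "fold otp b x = x \<and> word_act trn otp (word_sec trn otp b x) v = v"
    if "b \<in> set bs" "length v = D" for b and x :: 'x and v
  proof -
    have "word_act trn otp b (x # v) = x # v" using * that unfolding fixes_depth_def by simp
    then show ?thesis by (simp add: word_act_Cons_letter)
  qed
  have "fixes_letters bs"
    \<comment> \<open>Any word of length D will do as the tail when only the first letter
      matters.\<close>
    unfolding fixes_letters_def using step[OF _ length_replicate] by blast
  moreover have "fixes_depth D (next_level bs)"
    using step by (auto simp: fixes_depth_def next_level_def sec_blocks_def word_act_clean)
  ultimately show "fixes_letters bs \<and> fixes_depth D (next_level bs)" by blast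
next
  assume *: "fixes_letters bs \<and> fixes_depth D (next_level bs)"
  show "fixes_depth (Suc D) bs"
    unfolding fixes_depth_def
  proof (intro ballI allI impI)
    fix b and v :: "'x list" assume b: "b \<in> set bs" and "length v = Suc D"
    then obtain x v' where v: "v = x # v'" "length v' = D" by (auto simp: length_Suc_conv)
    let ?c = "clean (word_sec trn otp b x)"
    have "word_act trn otp ?c v' = v'"
    \<comment> \<open>An empty cleaned section is absent from the next level, but it acts trivially
      anyway.\<close>
    proof (cases "?c = []")
      case False
      then have "?c \<in> set (next_level bs)" using b xs(1) by (auto simp: next_level_def sec_blocks_def)
      then show ?thesis using * v(2) by (auto simp: fixes_depth_def)
    qed simp
    then show "word_act trn otp b v = v"
      using * b v by (simp add: word_act_Cons_letter word_act_clean fixes_letters_def)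
  qed
qed

lemma fixes_depth_iff: "fixes_depth D bs \<longleftrightarrow> (\<forall>k<D. fixes_letters ((next_level ^^ k) bs))"
proof (induction D arbitrary: bs)
  case 0
  show ?case by (simp add: fixes_depth_def)
next
  case (Suc D)
  then show ?case by (simp add: fixes_depth_Suc All_less_Suc2 funpow_swap1)
qed

lemma total_cost_le:
  assumes esc: "\<And>s k. esc s k \<le> Cd * Suc k ^ d" and w: "w \<noteq> []"
  shows "total_cost c r w \<le> (83 + 3 * c + 36 * r + (30 * length xs + 21) * (2 * Cd + 2)) *
    (length w * Suc (clock_value c r (length w)) ^ Suc d)"
proof -
  define n where "n = length w"
  define D where "D = clock_value c r n"
  define M where "M = Suc D ^ d"
  define Y where "Y = n * (Suc D * M)"
  \<comment> \<open>Bounds the encoded length of each level up to D: twice the weight gives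
    \<open>2 * Cd * (n * M)\<close>, and \<open>n + 1\<close> for level 0 is at most
    \<open>2 * (n * M)\<close>.\<close>
  define Q where "Q = (2 * Cd + 2) * (n * M)"
  have n: "1 \<le> n" using w by (simp add: n_def Suc_le_eq)
  have M: "1 \<le> M" by (simp add: M_def)
  have nM: "n * 1 \<le> n * M" using M by (rule mult_le_mono2)
  have Q_eq: "Q = 2 * (Cd * (n * M)) + n * M + n * M" by (simp add: Q_def algebra_simps)
  have len: "length (enc_blocks ((next_level ^^ k) [w])) \<le> Q" if k: "k \<le> D" for k
  proof -
    have "(\<Sum>s\<leftarrow>w. esc s k) \<le> (\<Sum>s\<leftarrow>w. Cd * M)"
    proof (rule sum_list_mono)
      fix s
      have "esc s k \<le> Cd * Suc k ^ d" by (rule esc)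
      also have "\<dots> \<le> Cd * M" using k unfolding M_def by (intro mult_le_mono2 power_mono) auto
      finally show "esc s k \<le> Cd * M" .
    qed
    also have "\<dots> = Cd * (n * M)" by (simp add: sum_list_triv n_def)
    finally have "(\<Sum>s\<leftarrow>w. esc s k) \<le> Cd * (n * M)" .
    then show ?thesis using length_level_le[of k w] n nM Q_eq unfolding n_def[symmetric] by linarith
  qed
  have Q: "1 \<le> Q" using n nM Q_eq by linarith
  have lev: "level_cost ((next_level ^^ k) [w]) + 3 \<le> (30 * length xs + 21) * Q" if k: "k < D" for k
  proof -
    have "level_cost ((next_level ^^ k) [w]) \<le> (20 * length xs + 4) * Q + 5 * Q + 10 * length xs + 9"
      unfolding level_cost_def using len[of k] len[of "Suc k"] k
      by (intro add_mono mult_le_mono) auto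
    moreover have "length xs * 1 \<le> length xs * Q" using Q by (rule mult_le_mono2)
    moreover have "(20 * length xs + 4) * Q + 5 * Q = 20 * (length xs * Q) + 9 * Q"
      "(30 * length xs + 21) * Q = 30 * (length xs * Q) + 21 * Q"
      by (simp_all add: algebra_simps)
    ultimately show ?thesis using Q by linarith
  qed
  have "(\<Sum>k<D. level_cost ((next_level ^^ k) [w]) + 3) \<le> (\<Sum>k<D. (30 * length xs + 21) * Q)"
    by (intro sum_mono lev) auto
  also have "\<dots> \<le> Suc D * ((30 * length xs + 21) * Q)" by simp
  also have "\<dots> = (30 * length xs + 21) * (2 * Cd + 2) * Y" by (simp only: Q_def Y_def ac_simps)
  finally have sum: "(\<Sum>k<D. level_cost ((next_level ^^ k) [w]) + 3) \<le> (30 * length xs + 21) * (2 * Cd + 2) * Y" .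
  have "1 * Suc D * 1 \<le> n * Suc D * M" using n M by (intro mult_le_mono) auto
  then have DY: "Suc D \<le> Y" unfolding Y_def by (simp only: mult.assoc mult_1 mult_1_right)
  have "n * 1 \<le> n * (Suc D * M)" using M by (intro mult_le_mono2) (auto simp: Suc_le_eq)
  then have nY: "n \<le> Y" by (simp add: Y_def)
  have c: "3 * c * 1 \<le> 3 * c * Y" using nY n by (intro mult_le_mono2) linarith
  have r: "r * (28 * D + 8) \<le> r * (36 * Y)" using DY by (intro mult_le_mono2) linarith
  have "total_cost c r w \<le> 53 * n + 3 * c + r * (28 * D + 8) + 30 + (30 * length xs + 21) * (2 * Cd + 2) * Y"
    using sum by (simp add: total_cost_def D_def n_def)
  \<comment> \<open>Everything is measured in \<open>Y\<close>, using 1 <= n <= \<open>Y\<close> and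
    D < \<open>Y\<close>; this is where 83 = 53 + 30 and 36 = 28 + 8 come from.\<close>
  also have "\<dots> \<le> 53 * Y + 3 * c * Y + r * (36 * Y) + 30 * Y + (30 * length xs + 21) * (2 * Cd + 2) * Y"
    using c r nY n by (intro add_mono) linarith+
  also have "\<dots> = (83 + 3 * c + 36 * r + (30 * length xs + 21) * (2 * Cd + 2)) * Y"
  proof -
    have "53 * Y + 3 * c * Y + r * (36 * Y) + 30 * Y + W * Y = (83 + 3 * c + 36 * r + W) * Y" for W
      by (simp add: algebra_simps)
    then show ?thesis .
  qed
  finally show ?thesis by (simp only: Y_def M_def D_def n_def power_Suc)
qed

end

text \<open>For n >= 3 the logarithm is at least 1 and absorbs additive constants. From
  \<open>2 ^ h\<close> <= n + 1 <= n * n one gets h ln 2 <= 2 ln n, and 2 ln 2 <= 2 ln n accounts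
  for the + 2; together they give the factor 4 / ln 2.\<close>

lemma clock_value_log_bound:
  assumes "3 \<le> n"
  shows "real (Suc (clock_value c r n)) \<le> (real c + 1) * (4 / ln 2 * ln (real n)) ^ r"
proof -
  define h where "h = half_rounds n"
  have ln1: "1 \<le> ln (real n)"
  proof -
    have "exp (1::real) \<le> 3" using exp_le by simp
    also have "\<dots> \<le> real n" using assms by simp
    finally show ?thesis using assms by (subst ln_ge_iff) auto
  qed
  have l2: "0 < ln (2::real)" "ln (2::real) \<le> 1" using ln_2_less_1 by auto
  have "(2::nat) ^ h \<le> n + 1" unfolding h_def by (rule half_rounds_lower)
  also have "\<dots> \<le> n * n" using assms mult_le_mono1[of 3 n n] by linarith
  finally have "real (2 ^ h) \<le> real (n * n)" by (simp only: of_nat_le_iff)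
  then have "ln (2 ^ h) \<le> ln (real n * real n)" using assms by (subst ln_le_cancel_iff) auto
  then have "real h * ln 2 \<le> 2 * ln (real n)" using assms by (simp add: ln_realpow ln_mult)
  moreover have "2 * ln 2 \<le> 2 * ln (real n)" using l2 ln1 by linarith
  ultimately have "real (h + 2) * ln 2 \<le> 4 * ln (real n)" by (simp add: algebra_simps)
  then have h: "real (h + 2) \<le> 4 / ln 2 * ln (real n)" using l2 by (simp add: field_simps)
  then have p: "real (h + 2) ^ r \<le> (4 / ln 2 * ln (real n)) ^ r" by (intro power_mono) auto
  have "1 \<le> real (h + 2) ^ r" by (intro one_le_power) simp
  then have "real (Suc (c * (h + 2) ^ r)) \<le> (real c + 1) * real (h + 2) ^ r"
    by (simp add: algebra_simps)
  also have "\<dots> \<le> (real c + 1) * (4 / ln 2 * ln (real n)) ^ r" using p by (intro mult_left_mono) auto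
  finally show ?thesis by (simp add: clock_value_def h_def)
qed

text \<open>The depth exponent r is all that distinguishes the two claims: r = d + 1 in general and
  r = 1 in the contracting case, each multiplied by the d + 1 of the level costs.\<close>

theorem (in polynomial_automaton) WP_in_DTIME:
  assumes depth: "\<forall>w t. length w \<le> 2 ^ t \<longrightarrow>
      (\<forall>v. length v = c * Suc t ^ r \<longrightarrow> word_act trn otp w v = v) \<longrightarrow> word_act trn otp w = id"
  shows "WP trn otp \<in> DTIME_star (\<lambda>n. real n * ln (real n) ^ (r * Suc d))"
proof -
  obtain xs :: "'x list" where xs: "set xs = UNIV" "distinct xs"
    using finite_distinct_list[OF finite_UNIV] by blast
  interpret P: section_program trn otp Triv xs
    by unfold_locales (use Triv_letter otp_bij xs in auto)
  define G where "G = 83 + 3 * c + 36 * r + (30 * length xs + 21) * (2 * Cd + 2)"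
  define C where "C = real G * ((real c + 1) * (4 / ln 2) ^ r) ^ Suc d"
  have bound: "real (P.total_cost c r w) \<le> C * (real (length w) * ln (real (length w)) ^ (r * Suc d))"
    if w: "3 \<le> length w" for w
  proof -
    let ?n = "length w"
    have "P.total_cost c r w \<le> G * (?n * Suc (clock_value c r ?n) ^ Suc d)"
      unfolding G_def by (intro P.total_cost_le) (use growth w in \<open>auto simp: Triv_def\<close>)
    then have "real (P.total_cost c r w) \<le> real (G * (?n * Suc (clock_value c r ?n) ^ Suc d))"
      by (simp only: of_nat_le_iff)
    also have "\<dots> = real G * (real ?n * real (Suc (clock_value c r ?n)) ^ Suc d)"
      by (simp only: of_nat_mult of_nat_power)
    also have "\<dots> \<le> real G * (real ?n * ((real c + 1) * (4 / ln 2 * ln (real ?n)) ^ r) ^ Suc d)"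
      by (intro mult_left_mono power_mono clock_value_log_bound w) simp_all
    also have "\<dots> = C * (real ?n * ln (real ?n) ^ (r * Suc d))"
      unfolding C_def by (simp only: power_mult_distrib power_mult ac_simps)
    finally show ?thesis .
  qed
  have correct: "(\<forall>k<clock_value c r (length w). P.fixes_letters ((P.next_level ^^ k) [w])) \<longleftrightarrow> w \<in> WP trn otp" for w
  proof -
    have eq: "clock_value c r (length w) = c * Suc (Suc (half_rounds (length w))) ^ r"
      by (simp add: clock_value_def)
    have "length w \<le> 2 ^ Suc (half_rounds (length w))" using half_rounds_upper[of "length w"] by linarith
    from depth[rule_format, OF this] show ?thesis
      unfolding P.fixes_depth_iff[symmetric] P.fixes_depth_def WP_def eq by auto
  qed
  show ?thesis
  \<comment> \<open>The initial letter is arbitrary because each pass sets its own; the last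
    component is the verdict, true until some block moves a letter.\<close>
  proof (rule DTIME_star_stack_program[where K = 7 and c = "P.wp_program c r" and h = Some and N = 3
        and A = "\<lambda>q. snd (snd (snd q))" and C = C and ?q0.0 = "(None, undefined, False, True)"])
    show "stacks_below 7 (P.wp_program c r)" by (rule P.stacks_below_wp_program)
    fix w
    obtain q S n where n: "n \<le> P.total_cost c r w"
      "exec (P.wp_program c r) ((None, undefined, False, True), (\<lambda>_. [])(0 := map Some w)) n (q, S)"
      "snd (snd (snd q)) \<longleftrightarrow> (\<forall>k<clock_value c r (length w). P.fixes_letters ((P.next_level ^^ k) [w]))"
      using P.runs_wp_program[of c r undefined False w] unfolding runs_def by blast
    have "real n \<le> C * (real (length w) * ln (real (length w)) ^ (r * Suc d))" if "3 \<le> length w"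
      using n(1) bound[OF that] by linarith
    then show "\<exists>n q S. exec (P.wp_program c r) ((None, undefined, False, True), (\<lambda>_. [])(0 := map Some w)) n (q, S) \<and>
      (snd (snd (snd q)) \<longleftrightarrow> w \<in> WP trn otp) \<and>
      (3 \<le> length w \<longrightarrow> real n \<le> C * (real (length w) * ln (real (length w)) ^ (r * Suc d)))"
      using n(2,3) correct[of w] by blast
  qed auto
qed

lemma poly_le_power:
  fixes P :: "real poly"
  shows "\<exists>C::nat. \<forall>n. poly P (real n) \<le> real (C * Suc n ^ degree P)"
proof -
  define A where "A = (\<Sum>i\<le>degree P. \<bar>coeff P i\<bar>)"
  obtain C :: nat where C: "A \<le> real C" using real_arch_simple by blast
  have "poly P (real n) \<le> real (C * Suc n ^ degree P)" for n
  proof -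
    have "poly P (real n) \<le> (\<Sum>i\<le>degree P. \<bar>coeff P i\<bar> * real (Suc n) ^ degree P)"
      unfolding poly_altdef
    proof (rule sum_mono)
      fix i assume i: "i \<in> {..degree P}"
      have "coeff P i * real n ^ i \<le> \<bar>coeff P i\<bar> * real n ^ i" by (intro mult_right_mono) auto
      also have "\<dots> \<le> \<bar>coeff P i\<bar> * real (Suc n) ^ i" by (intro mult_left_mono power_mono) auto
      also have "\<dots> \<le> \<bar>coeff P i\<bar> * real (Suc n) ^ degree P"
        using i by (intro mult_left_mono power_increasing) auto
      finally show "coeff P i * real n ^ i \<le> \<bar>coeff P i\<bar> * real (Suc n) ^ degree P" .
    qed
    also have "\<dots> = A * real (Suc n) ^ degree P" by (simp add: A_def sum_distrib_right)
    also have "\<dots> \<le> real C * real (Suc n) ^ degree P" using C by (intro mult_right_mono) auto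
    finally show ?thesis by (simp only: of_nat_mult of_nat_power)
  qed
  then show ?thesis by blast
qed

lemma polynomial_automatonI:
  fixes trn :: "'s::finite \<Rightarrow> 'x::finite \<Rightarrow> 's"
  assumes "invertible_aut otp" "minimal_aut trn otp" "polynomial_aut trn otp"
  shows "\<exists>C. polynomial_automaton trn otp C (aut_degree trn otp)"
proof -
  let ?d = "aut_degree trn otp"
  have "poly_bound_of_degree trn otp ?d"
    using assms(3) LeastI_ex[of "poly_bound_of_degree trn otp"] by (simp add: polynomial_aut_def aut_degree_def)
  then obtain P :: "real poly" where P: "degree P = ?d"
    "\<And>s n. real (nontriv_count trn otp s n) \<le> poly P (real n)"
    by (auto simp: poly_bound_of_degree_def)
  obtain C where C: "\<And>n. poly P (real n) \<le> real (C * Suc n ^ ?d)" using poly_le_power[of P] P(1) by auto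
  have "escape_count trn {s. aut_out trn otp s = id} s n \<le> C * Suc n ^ ?d" for s n
  proof -
    have "escape_count trn {s. aut_out trn otp s = id} s n = nontriv_count trn otp s n"
      by (simp add: escape_count_eq_card nontriv_count_def)
    moreover have "real (nontriv_count trn otp s n) \<le> real (C * Suc n ^ ?d)" using P(2) C by (rule order_trans)
    ultimately show ?thesis by (simp only: of_nat_le_iff)
  qed
  then have "polynomial_automaton trn otp C ?d"
    using assms(1,2) by unfold_locales (auto simp: invertible_aut_def minimal_aut_def)
  then show ?thesis by blast
qed

theorem mainTheorem11:
  fixes trn :: "'s::finite \<Rightarrow> 'x::finite \<Rightarrow> 's"
    and otp :: "'s \<Rightarrow> 'x \<Rightarrow> 'x"
    and d :: nat
  assumes "invertible_aut otp"
    and "minimal_aut trn otp"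
    and "inverse_closed_aut trn otp"
    and "polynomial_aut trn otp"
    and "d = aut_degree trn otp"
  shows "WP trn otp \<in> DTIME_star (\<lambda>n. real n * (ln (real n)) ^ ((d + 1)^2))
       \<and> (contracting_aut trn otp \<longrightarrow>
            WP trn otp \<in> DTIME_star (\<lambda>n. real n * (ln (real n)) ^ (d + 1)))"
proof -
  obtain Cd where "polynomial_automaton trn otp Cd d"
    using polynomial_automatonI assms by blast
  then interpret polynomial_automaton trn otp Cd d .
  have sq: "Suc d * Suc d = (d + 1)\<^sup>2" and one: "1 * Suc d = d + 1" by (simp_all add: power2_eq_square)
  show ?thesis
  proof (intro conjI impI)
    obtain C where "\<forall>w t. length w \<le> 2 ^ t \<longrightarrow>
        (\<forall>v. length v = C * Suc t ^ Suc d \<longrightarrow> word_act trn otp w v = v) \<longrightarrow> word_act trn otp w = id"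
      using detection_depth by blast
    from WP_in_DTIME[OF this] show "WP trn otp \<in> DTIME_star (\<lambda>n. real n * (ln (real n)) ^ ((d + 1)^2))"
      by (simp only: sq)
  next
    assume "contracting_aut trn otp"
    then obtain C where "\<forall>w t. length w \<le> 2 ^ t \<longrightarrow>
        (\<forall>v. length v = C * Suc t ^ 1 \<longrightarrow> word_act trn otp w v = v) \<longrightarrow> word_act trn otp w = id"
      using contracting_depth by blast
    from WP_in_DTIME[OF this] show "WP trn otp \<in> DTIME_star (\<lambda>n. real n * (ln (real n)) ^ (d + 1))"
      by (simp only: one)
  qed
qed

end
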